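(* Let $n\in\mathbb{N}$, $[a,b]\subseteq\mathbb{R}$, and write $L_2^n=L_2^n[a,b]$. Let $D\subseteq L_2^n$ be a linear subspace, and let $\mathcal{T}:L_{2}^{n}\to D$ and $\mathcal{A}:L_{2}^{n}\to L_2^n$ be bounded linear operators, with $\mathcal{T}$ bijective (onto $D$). Define $A:=\mathcal{A}\circ\mathcal{T}^{-1}:D\to L_{2}^{n}$. Let $\omega\in\mathbb{R}$ and suppose the following conditions are satisfied: (1) there exist $\epsilon_{1}>0$ and $\mathcal{P}\in\mathcal{L}(L_{2}^{n})$ such that $\mathcal{P}\succeq\epsilon_{1}^{2}I$ and $$\langle \mathcal{T}\mathbf{v},\mathcal{A}\mathbf{v}\rangle_{L_{2,\mathcal{P}}}\le\omega\langle \mathcal{T}\mathbf{v},\mathcal{T}\mathbf{v}\rangle_{L_{2,\mathcal{P}}}\quad\text{for all } \mathbf{v}\in L_{2}^{n};$$ (2) there exist $\epsilon_{2}>0$ and $\lambda>\omega$ such that $$\|(\lambda\mathcal{T}^*-\mathcal{A}^* )\mathbf{v}\|_{L_{2}}\ge \epsilon_{2}\|\mathbf{v}\|_{L_{2}}\quad\text{for all }\mathbf{v}\in L_{2}^{n}.$$ Then $A$ is the infinitesimal generator of a $C_{0}$-semigroup on $L_{2}^n$ with growth rate $\omega$ and gain $M:=\frac{\sqrt{\|\mathcal{P}\|_{\mathcal{L}(L_{2})}}}{\epsilon_{1}}$, for $\epsilon_1,\mathcal{P}$ as in condition (1).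
   Context: $L_2^n[a,b]$ is the real Hilbert space of $\mathbb{R}^n$-valued square-integrable functions on $[a,b]$ with the standard inner product $\langle\cdot,\cdot\rangle_{L_2}$; $\mathcal{L}(L_2^n)$ is the space of bounded linear operators on it, with operator norm $\|\cdot\|_{\mathcal{L}(L_2)}$. $D$ carries the $L_2$ norm, so $\mathcal{T}$ is regarded as a bounded operator on $L_2^n$, and $\mathcal{T}^*,\mathcal{A}^*$ are adjoints with respect to the standard $L_2$ inner product. $\mathcal{P}\succeq\epsilon_1^2 I$ means that $\mathcal{P}$ is self-adjoint and $\langle\mathbf{v},\mathcal{P}\mathbf{v}\rangle_{L_2}\ge\epsilon_1^2\|\mathbf{v}\|_{L_2}^2$ for all $\mathbf{v}$. For such $\mathcal{P}$, the weighted inner product is $\langle\mathbf{x},\mathbf{y}\rangle_{L_{2,\mathcal{P}}}:=\langle\mathbf{x},\mathcal{P}\mathbf{y}\rangle_{L_2}$. A $C_0$-semigroup on a Hilbert space $H$ is a family $(S(t))_{t\ge 0}$ in $\mathcal{L}(H)$ with $S(0)=I$, $S(t+s)=S(t)S(s)$ for all $t,s\ge 0$, and $\lim_{t\to0^+}S(t)\mathbf{x}=\mathbf{x}$ for all $\mathbf{x}\in H$. Its infinitesimal generator is the operator $\mathbf{x}\mapsto \lim_{t\to 0^+}\frac{1}{t}[S(t)-I]\mathbf{x}$, whose domain is exactly the set of all $\mathbf{x}\in H$ for which this limit exists in $H$; saying that $A:D\to H$ is the infinitesimal generator includes the statement that this domain equals $D$. A $C_0$-semigroup $(S(t))_{t\ge0}$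 on $H$ has growth rate $\omega\in\mathbb{R}$ and gain $M\ge1$ if $\|S(t)\|_{\mathcal{L}(H)}\le Me^{\omega t}$ for all $t\ge0$. *)

theory Defs
  imports "HOL-Analysis.Analysis"
begin

section \<open>Square-integrable functions modulo equality almost everywhere\<close>

definition square_integrable :: "(real \<Rightarrow> 'a::euclidean_space) \<Rightarrow> bool" where
  "square_integrable f \<longleftrightarrow>
     f \<in> borel_measurable lebesgue \<and> integrable lebesgue (\<lambda>x. (norm (f x))\<^sup>2)"

lemma square_integrable_inner:
  assumes "square_integrable f" "square_integrable g"
  shows "integrable lebesgue (\<lambda>x. f x \<bullet> g x)"
proof (rule Bochner_Integration.integrable_bound)
  show "integrable lebesgue (\<lambda>x. (norm (f x))\<^sup>2 + (norm (g x))\<^sup>2)"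
    using assms by (auto simp: square_integrable_def)
  show "(\<lambda>x. f x \<bullet> g x) \<in> borel_measurable lebesgue"
    using assms by (auto simp: square_integrable_def)
  have "norm (f x \<bullet> g x) \<le> norm ((norm (f x))\<^sup>2 + (norm (g x))\<^sup>2)" for x
  proof -
    have "\<bar>f x \<bullet> g x\<bar> \<le> norm (f x) * norm (g x)"
      by (rule Cauchy_Schwarz_ineq2)
    also have "\<dots> \<le> (norm (f x))\<^sup>2 + (norm (g x))\<^sup>2"
      using sum_squares_bound[of "norm (f x)" "norm (g x)"]
        mult_nonneg_nonneg[OF norm_ge_zero[of "f x"] norm_ge_zero[of "g x"]] by linarith
    finally show ?thesis by simp
  qed
  then show "AE x in lebesgue. norm (f x \<bullet> g x) \<le> norm ((norm (f x))\<^sup>2 + (norm (g x))\<^sup>2)"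
    by simp
qed

lemma square_integrable_zero: "square_integrable (\<lambda>x. 0)"
  by (simp add: square_integrable_def)

lemma square_integrable_scaleR:
  assumes "square_integrable f"
  shows "square_integrable (\<lambda>x. c *\<^sub>R f x)"
  using assms by (auto simp: square_integrable_def power_mult_distrib)

lemma square_integrable_add:
  assumes "square_integrable f" "square_integrable g"
  shows "square_integrable (\<lambda>x. f x + g x)"
proof -
  have "(norm (f x + g x))\<^sup>2 = (norm (f x))\<^sup>2 + 2 * (f x \<bullet> g x) + (norm (g x))\<^sup>2" for x
    by (simp add: power2_norm_eq_inner inner_add_left inner_add_right inner_commute)
  then show ?thesis
    using assms square_integrable_inner[OF assms] by (auto simp: square_integrable_def)
qed

lemma square_integrable_uminus:
  "square_integrable f \<Longrightarrow> square_integrable (\<lambda>x. - f x)"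
  using square_integrable_scaleR[of f "-1"] by simp

lemma square_integrable_diff:
  "square_integrable f \<Longrightarrow> square_integrable g \<Longrightarrow> square_integrable (\<lambda>x. f x - g x)"
  using square_integrable_add[of f "\<lambda>x. - g x"] square_integrable_uminus[of g] by simp

definition L2_rel :: "(real \<Rightarrow> 'a::euclidean_space) \<Rightarrow> (real \<Rightarrow> 'a) \<Rightarrow> bool" where
  "L2_rel f g \<longleftrightarrow> square_integrable f \<and> square_integrable g \<and> (AE x in lebesgue. f x = g x)"

lemma part_equivp_L2_rel: "part_equivp L2_rel"
proof (rule part_equivpI)
  show "\<exists>f. L2_rel f f"
    by (rule exI[of _ "\<lambda>x. 0"]) (simp add: L2_rel_def square_integrable_zero)
  show "symp L2_rel"
    by (auto simp: symp_def L2_rel_def eq_commute)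
  show "transp L2_rel"
    unfolding transp_def L2_rel_def by (auto elim: AE_mp)
qed

text \<open>\<open>'a L2\<close> is \<open>L\<^sub>2(\<real>; 'a)\<close>; since a type cannot depend on the end points, the
  spaces over compact intervals appear below as subspaces of it.\<close>

quotient_type (overloaded) 'a L2 = "real \<Rightarrow> 'a::euclidean_space" / partial: L2_rel
  by (rule part_equivp_L2_rel)

instantiation L2 :: (euclidean_space) real_inner
begin

lift_definition zero_L2 :: "'a L2" is "\<lambda>x. 0"
  by (simp add: L2_rel_def square_integrable_zero)

lift_definition plus_L2 :: "'a L2 \<Rightarrow> 'a L2 \<Rightarrow> 'a L2" is "\<lambda>f g x. f x + g x"
  unfolding L2_rel_def by (auto intro: square_integrable_add)

lift_definition minus_L2 :: "'a L2 \<Rightarrow> 'a L2 \<Rightarrow> 'a L2" is "\<lambda>f g x. f x - g x"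
  unfolding L2_rel_def by (auto intro: square_integrable_diff)

lift_definition uminus_L2 :: "'a L2 \<Rightarrow> 'a L2" is "\<lambda>f x. - f x"
  unfolding L2_rel_def by (auto intro: square_integrable_uminus)

lift_definition scaleR_L2 :: "real \<Rightarrow> 'a L2 \<Rightarrow> 'a L2" is "\<lambda>c f x. c *\<^sub>R f x"
  unfolding L2_rel_def by (auto intro: square_integrable_scaleR)

lift_definition inner_L2 :: "'a L2 \<Rightarrow> 'a L2 \<Rightarrow> real" is "\<lambda>f g. LINT x|lebesgue. f x \<bullet> g x"
proof -
  fix f f' g g' :: "real \<Rightarrow> 'a"
  assume "L2_rel f f'" "L2_rel g g'"
  then show "(LINT x|lebesgue. f x \<bullet> g x) = (LINT x|lebesgue. f' x \<bullet> g' x)"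
    unfolding L2_rel_def
    by (intro integral_cong_AE) (auto simp: square_integrable_def)
qed

definition norm_L2 :: "'a L2 \<Rightarrow> real" where
  "norm_L2 u = sqrt (inner u u)"

definition sgn_L2 :: "'a L2 \<Rightarrow> 'a L2" where
  "sgn_L2 u = scaleR (inverse (norm u)) u"

definition dist_L2 :: "'a L2 \<Rightarrow> 'a L2 \<Rightarrow> real" where
  "dist_L2 u v = norm (u - v)"

definition uniformity_L2 :: "('a L2 \<times> 'a L2) filter" where
  "uniformity_L2 = (INF e\<in>{0 <..}. principal {(u, v). dist u v < e})"

definition open_L2 :: "'a L2 set \<Rightarrow> bool" where
  "open_L2 U \<longleftrightarrow> (\<forall>u\<in>U. \<forall>\<^sub>F (u', v) in uniformity. u' = u \<longrightarrow> v \<in> U)"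

instance
proof
  fix u v w :: "'a L2" and c d :: real and U :: "'a L2 set"
  show "u + v + w = u + (v + w)"
    by transfer (auto simp: L2_rel_def add.assoc intro: square_integrable_add)
  show "u + v = v + u"
    by transfer (auto simp: L2_rel_def add.commute intro: square_integrable_add)
  show "0 + u = u"
    by transfer (auto simp: L2_rel_def)
  show "- u + u = 0"
    by transfer (auto simp: L2_rel_def square_integrable_zero)
  show "u - v = u + - v"
    by transfer (auto simp: L2_rel_def intro: square_integrable_diff)
  show "c *\<^sub>R (u + v) = c *\<^sub>R u + c *\<^sub>R v"
    by transfer (auto simp: L2_rel_def scaleR_add_right
        intro!: square_integrable_add square_integrable_scaleR)
  show "(c + d) *\<^sub>R u = c *\<^sub>R u + d *\<^sub>R u"
    by transfer (auto simp: L2_rel_def scaleR_add_left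
        intro!: square_integrable_add square_integrable_scaleR)
  show "c *\<^sub>R d *\<^sub>R u = (c * d) *\<^sub>R u"
    by transfer (auto simp: L2_rel_def intro!: square_integrable_scaleR)
  show "1 *\<^sub>R u = u"
    by transfer (auto simp: L2_rel_def)
  show "dist u v = norm (u - v)"
    by (rule dist_L2_def)
  show "sgn u = scaleR (inverse (norm u)) u"
    by (rule sgn_L2_def)
  show "uniformity = (INF e\<in>{0 <..}. principal {(u, v::'a L2). dist u v < e})"
    by (rule uniformity_L2_def)
  show "open U \<longleftrightarrow> (\<forall>u\<in>U. \<forall>\<^sub>F (u', v) in uniformity. u' = u \<longrightarrow> v \<in> U)"
    by (rule open_L2_def)
  show "inner u v = inner v u"
    by transfer (simp add: inner_commute)
  show "inner (u + v) w = inner u w + inner v w"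
    by transfer (simp add: L2_rel_def inner_add_left square_integrable_inner)
  show "inner (c *\<^sub>R u) v = c * inner u v"
    by transfer simp
  show "0 \<le> inner u u"
    by transfer simp
  show "inner u u = 0 \<longleftrightarrow> u = 0"
  proof transfer
    fix f :: "real \<Rightarrow> 'a"
    assume "L2_rel f f"
    then have f: "square_integrable f"
      by (simp add: L2_rel_def)
    have "(LINT x|lebesgue. f x \<bullet> f x) = 0 \<longleftrightarrow> (AE x in lebesgue. f x \<bullet> f x = 0)"
      using square_integrable_inner[OF f f] by (intro integral_nonneg_eq_0_iff_AE) auto
    then show "(LINT x|lebesgue. f x \<bullet> f x) = 0 \<longleftrightarrow> L2_rel f (\<lambda>x. 0)"
      using f by (simp add: L2_rel_def square_integrable_zero)
  qed
  show "norm u = sqrt (inner u u)"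
    by (rule norm_L2_def)
qed

end

text \<open>\<open>L2_on a b\<close> is \<open>L\<^sub>2[a,b]\<close>: a function on \<open>[a,b]\<close> is extended by zero to the real line.
  The two lemmas after the definition confirm that this is the usual space, with the usual
  inner product.\<close>

lift_definition vanishes_off :: "real set \<Rightarrow> 'a::euclidean_space L2 \<Rightarrow> bool"
  is "\<lambda>S f. AE x in lebesgue. x \<notin> S \<longrightarrow> f x = 0"
  unfolding L2_rel_def by (auto elim: AE_mp)

definition L2_on :: "real \<Rightarrow> real \<Rightarrow> 'a::euclidean_space L2 set" where
  "L2_on a b = {u. vanishes_off {a..b} u}"

definition L2_of :: "real \<Rightarrow> real \<Rightarrow> (real \<Rightarrow> 'a::euclidean_space) \<Rightarrow> 'a L2" where
  "L2_of a b f = abs_L2 (\<lambda>x. indicator {a..b} x *\<^sub>R f x)"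

lemma square_integrable_indicator_iff:
  "square_integrable (\<lambda>x. indicator {a..b} x *\<^sub>R f x) \<longleftrightarrow>
     f \<in> borel_measurable (lebesgue_on {a..b}) \<and>
     integrable (lebesgue_on {a..b}) (\<lambda>x. (norm (f x))\<^sup>2)"
proof -
  have "(norm (indicator {a..b} x *\<^sub>R f x))\<^sup>2 = indicator {a..b} x *\<^sub>R (norm (f x))\<^sup>2" for x
    by (simp add: indicator_def)
  then show ?thesis
    by (simp add: square_integrable_def borel_measurable_restrict_space_iff
        integrable_restrict_space)
qed

lemma L2_on_eq:
  "L2_on a b = L2_of a b ` {f. f \<in> borel_measurable (lebesgue_on {a..b}) \<and>
     integrable (lebesgue_on {a..b}) (\<lambda>x. (norm (f x))\<^sup>2)}"
  (is "_ = _ ` ?Q")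
proof (intro set_eqI iffI)
  fix u :: "'a L2"
  assume "u \<in> L2_on a b"
  define f where "f = rep_L2 u"
  have u: "u = abs_L2 f"
    unfolding f_def by (rule Quotient_abs_rep[OF Quotient_L2, symmetric])
  have r: "L2_rel f f"
    unfolding f_def by (rule Quotient_rep_reflp[OF Quotient_L2])
  have ae: "AE x in lebesgue. x \<notin> {a..b} \<longrightarrow> f x = 0"
    using \<open>u \<in> L2_on a b\<close> r unfolding L2_on_def u by (simp add: vanishes_off.abs_eq)
  have sq: "square_integrable f"
    using r by (simp add: L2_rel_def)
  then have m: "f \<in> borel_measurable lebesgue"
    by (simp add: square_integrable_def)
  let ?g = "\<lambda>x. indicator {a..b} x *\<^sub>R f x"
  have g: "?g \<in> borel_measurable lebesgue"
    using m by (intro borel_measurable_scaleR borel_measurable_indicator) auto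
  have "integrable lebesgue (\<lambda>x. (norm (?g x))\<^sup>2)"
  proof (rule Bochner_Integration.integrable_bound)
    show "integrable lebesgue (\<lambda>x. (norm (f x))\<^sup>2)"
      using sq by (simp add: square_integrable_def)
    show "(\<lambda>x. (norm (?g x))\<^sup>2) \<in> borel_measurable lebesgue"
      by (intro borel_measurable_power measurable_compose[OF g borel_measurable_norm])
    show "AE x in lebesgue. norm ((norm (?g x))\<^sup>2) \<le> norm ((norm (f x))\<^sup>2)"
      by (rule AE_I2) (simp add: indicator_def)
  qed
  with g have sg: "square_integrable ?g"
    by (simp add: square_integrable_def)
  have "AE x in lebesgue. ?g x = f x"
    using ae by eventually_elim (auto simp: indicator_def)
  then have "L2_rel ?g f"
    using sq sg by (simp add: L2_rel_def)
  then have "L2_of a b f = u"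
    unfolding L2_of_def u by (rule Quotient_rel_abs[OF Quotient_L2])
  moreover have "f \<in> ?Q"
    using sg by (simp add: square_integrable_indicator_iff)
  ultimately show "u \<in> L2_of a b ` ?Q"
    by blast
next
  fix u :: "'a L2"
  assume "u \<in> L2_of a b ` ?Q"
  then obtain f where u: "u = L2_of a b f"
    and "square_integrable (\<lambda>x. indicator {a..b} x *\<^sub>R f x)"
    by (auto simp: square_integrable_indicator_iff)
  then show "u \<in> L2_on a b"
    by (simp add: L2_on_def L2_of_def vanishes_off.abs_eq L2_rel_def indicator_def)
qed

lemma inner_L2_of:
  assumes "f \<in> borel_measurable (lebesgue_on {a..b})"
    "integrable (lebesgue_on {a..b}) (\<lambda>x. (norm (f x))\<^sup>2)"
    "g \<in> borel_measurable (lebesgue_on {a..b})"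
    "integrable (lebesgue_on {a..b}) (\<lambda>x. (norm (g x))\<^sup>2)"
  shows "L2_of a b f \<bullet> L2_of a b g = (LINT x|lebesgue_on {a..b}. f x \<bullet> g x)"
proof -
  have "square_integrable (\<lambda>x. indicator {a..b} x *\<^sub>R f x)"
    "square_integrable (\<lambda>x. indicator {a..b} x *\<^sub>R g x)"
    using assms by (simp_all add: square_integrable_indicator_iff)
  then have "L2_of a b f \<bullet> L2_of a b g =
      (LINT x|lebesgue. (indicator {a..b} x *\<^sub>R f x) \<bullet> (indicator {a..b} x *\<^sub>R g x))"
    by (simp add: L2_of_def inner_L2.abs_eq L2_rel_def)
  also have "\<dots> = (LINT x|lebesgue. indicator {a..b} x *\<^sub>R (f x \<bullet> g x))"
    by (rule Bochner_Integration.integral_cong) (auto simp: indicator_def)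
  also have "\<dots> = (LINT x|lebesgue_on {a..b}. f x \<bullet> g x)"
    by (simp add: integral_restrict_space)
  finally show ?thesis .
qed

section \<open>Bounded operators and semigroups on a Hilbert space \<open>H\<close>\<close>

text \<open>\<open>H\<close> is a complete linear subspace of a real inner product space; operators on \<open>H\<close> are
  functions on the ambient type whose values outside \<open>H\<close> are irrelevant.\<close>

definition bounded_linear_op_on :: "'h::real_inner set \<Rightarrow> ('h \<Rightarrow> 'h) \<Rightarrow> bool" where
  "bounded_linear_op_on H T \<longleftrightarrow>
     T ` H \<subseteq> H \<and>
     (\<forall>x\<in>H. \<forall>y\<in>H. T (x + y) = T x + T y) \<and>
     (\<forall>c. \<forall>x\<in>H. T (c *\<^sub>R x) = c *\<^sub>R T x) \<and>
     (\<exists>C. \<forall>x\<in>H. norm (T x) \<le> C * norm x)"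

text \<open>As in \<^const>\<open>onorm\<close>, \<open>x = 0\<close> contributes \<open>0 / 0 = 0\<close> to the supremum.\<close>

definition opnorm_on :: "'h::real_inner set \<Rightarrow> ('h \<Rightarrow> 'h) \<Rightarrow> real" where
  "opnorm_on H T = (SUP x\<in>H. norm (T x) / norm x)"

text \<open>For \<open>H\<close> complete and \<open>T\<close> bounded on \<open>H\<close>, the described element exists uniquely for
  every \<open>y \<in> H\<close> by the Riesz representation theorem.\<close>

definition adjoint_on :: "'h::real_inner set \<Rightarrow> ('h \<Rightarrow> 'h) \<Rightarrow> 'h \<Rightarrow> 'h" where
  "adjoint_on H T y = (THE z. z \<in> H \<and> (\<forall>x\<in>H. T x \<bullet> y = x \<bullet> z))"

definition self_adjoint_on :: "'h::real_inner set \<Rightarrow> ('h \<Rightarrow> 'h) \<Rightarrow> bool" where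
  "self_adjoint_on H P \<longleftrightarrow> (\<forall>x\<in>H. \<forall>y\<in>H. P x \<bullet> y = x \<bullet> P y)"

text \<open>\<open>P \<succeq> c I\<close> on \<open>H\<close>.\<close>

definition coercive_on :: "'h::real_inner set \<Rightarrow> real \<Rightarrow> ('h \<Rightarrow> 'h) \<Rightarrow> bool" where
  "coercive_on H c P \<longleftrightarrow>
     self_adjoint_on H P \<and> (\<forall>v\<in>H. v \<bullet> P v \<ge> c * (norm v)\<^sup>2)"

definition weighted_inner :: "('h::real_inner \<Rightarrow> 'h) \<Rightarrow> 'h \<Rightarrow> 'h \<Rightarrow> real" where
  "weighted_inner P x y = x \<bullet> P y"

definition C0_semigroup_on :: "'h::real_inner set \<Rightarrow> (real \<Rightarrow> 'h \<Rightarrow> 'h) \<Rightarrow> bool" where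
  "C0_semigroup_on H S \<longleftrightarrow>
     (\<forall>t\<ge>0. bounded_linear_op_on H (S t)) \<and>
     (\<forall>x\<in>H. S 0 x = x) \<and>
     (\<forall>t\<ge>0. \<forall>s\<ge>0. \<forall>x\<in>H. S (t + s) x = S t (S s x)) \<and>
     (\<forall>x\<in>H. ((\<lambda>t. S t x) \<longlongrightarrow> x) (at_right 0))"

definition infinitesimal_generator_on ::
    "'h::real_inner set \<Rightarrow> (real \<Rightarrow> 'h \<Rightarrow> 'h) \<Rightarrow> 'h set \<Rightarrow> ('h \<Rightarrow> 'h) \<Rightarrow> bool" where
  "infinitesimal_generator_on H S D A \<longleftrightarrow>
     D = {x\<in>H. \<exists>y\<in>H. ((\<lambda>t. (1 / t) *\<^sub>R (S t x - x)) \<longlongrightarrow> y) (at_right 0)} \<and>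
     (\<forall>x\<in>D. ((\<lambda>t. (1 / t) *\<^sub>R (S t x - x)) \<longlongrightarrow> A x) (at_right 0))"

definition has_growth_on ::
    "'h::real_inner set \<Rightarrow> (real \<Rightarrow> 'h \<Rightarrow> 'h) \<Rightarrow> real \<Rightarrow> real \<Rightarrow> bool" where
  "has_growth_on H S \<omega> M \<longleftrightarrow> M \<ge> 1 \<and> (\<forall>t\<ge>0. opnorm_on H (S t) \<le> M * exp (\<omega> * t))"

end

theory Submission
  imports Defs
begin

text \<open>After replacing \<open>\<A>\<close> by \<open>\<A> - \<omega> T\<close>, condition (1) says that \<open>A\<close> is dissipative in the
  \<open>P\<close>-inner product, and (2) makes one operator \<open>T - h \<A>\<close> surjective; a contraction argument in the
  \<open>P\<close>-norm spreads surjectivity to all \<open>h > 0\<close>. The resolvents \<open>J h = (I - h A)\<^sup>-\<^sup>1\<close> are then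
  \<open>P\<close>-contractions, so their powers are uniformly bounded by \<open>M\<close> in the \<open>L\<^sub>2\<close> norm, and the domain is
  dense because a dissipative operator with surjective \<open>I - A\<close> on a Hilbert space has no
  nonzero vector \<open>P\<close>-orthogonal to its domain. The semigroup is the limit of the implicit Euler scheme with
  step \<open>2\<^sup>-\<^sup>k\<close>: on the domain of \<open>A\<^sup>2\<close>, halving the step changes the approximation by \<open>O(2\<^sup>-\<^sup>k)\<close>.\<close>

text \<open>This is the Lumer-Phillips theorem for a Hilbert norm equivalent to the given one. The
  obstacle is the gap between the two norms: resolvents contract only in the \<open>P\<close>-norm,
  so an \<open>L2\<close> estimate that bounds a product of resolvents factor by factor would
  collect a power of \<open>M\<close>. The construction of the semigroup therefore knows
  \<open>P\<close> only through the bound on \<open>J h ^^ n\<close>, and its error estimates merge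
  resolvents of equal step into one power before taking norms. Euler's scheme fits this constraint
  because its approximants are themselves powers of resolvents. Working with
  \<open>T v - h *\<^sub>R B v\<close> instead of the unbounded \<open>I - h A\<close> keeps every
  equation defined on all of \<open>H\<close>.\<close>

lemma Cauchy_of_geometric_steps:
  fixes X :: "nat \<Rightarrow> 'a::real_normed_vector"
  assumes q: "0 \<le> q" "q < 1" and step: "\<And>n. norm (X (Suc n) - X n) \<le> C * q ^ n"
  shows "Cauchy X"
proof -
  \<comment> \<open>No sign of \<open>C\<close> is assumed; the step bound at index 0 forces
    it.\<close>
  have C: "0 \<le> C"
    using order_trans[OF norm_ge_zero step[of 0]] by simp
  have partial: "norm (X (m + k) - X m) \<le> C * q ^ m * (\<Sum>i<k. q ^ i)" for m k
  proof (induction k)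
    case (Suc k)
    have "norm (X (m + Suc k) - X m) \<le> norm (X (Suc (m + k)) - X (m + k)) + norm (X (m + k) - X m)"
      using norm_triangle_ineq[of "X (Suc (m + k)) - X (m + k)" "X (m + k) - X m"] by simp
    also have "\<dots> \<le> C * q ^ (m + k) + C * q ^ m * (\<Sum>i<k. q ^ i)"
      using step Suc.IH by (intro add_mono)
    finally show ?case
      by (simp add: algebra_simps power_add)
  qed simp
  have geo: "(\<Sum>i<k. q ^ i) \<le> 1 / (1 - q)" for k
    using q sum_le_suminf[of "\<lambda>i. q ^ i" "{..<k}"] by (simp add: summable_geometric suminf_geometric)
  have bound: "norm (X (m + k) - X m) \<le> C / (1 - q) * q ^ m" for m k
  proof -
    have "C * q ^ m * (\<Sum>i<k. q ^ i) \<le> C * q ^ m * (1 / (1 - q))"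
      using C q geo by (intro mult_left_mono) auto
    with partial[of m k] show ?thesis by (simp add: field_simps)
  qed
  have lim: "(\<lambda>m. C / (1 - q) * q ^ m) \<longlonglongrightarrow> 0"
    using q by (intro tendsto_mult_right_zero LIMSEQ_realpow_zero) auto
  show ?thesis
  proof (rule CauchyI')
    fix e :: real assume "e > 0"
    from order_tendstoD(2)[OF lim this] obtain N where N: "\<And>m. m \<ge> N \<Longrightarrow> C / (1 - q) * q ^ m < e"
      by (auto simp: eventually_sequentially)
    show "\<exists>N. \<forall>m\<ge>N. \<forall>n>m. dist (X m) (X n) < e"
    proof (intro exI allI impI)
      fix m n assume "N \<le> m" "m < n"
      with bound[of m "n - m"] N[of m] show "dist (X m) (X n) < e"
        by (simp add: dist_norm norm_minus_commute)
    qed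
  qed
qed

section \<open>Completeness of \<open>L\<^sub>2\<close>\<close>

lemma rep_L2: "square_integrable (rep_L2 u)" "abs_L2 (rep_L2 u) = u"
  using Quotient_rep_reflp[OF Quotient_L2, of u] Quotient_abs_rep[OF Quotient_L2, of u]
  by (auto simp: L2_rel_def)

lemma norm_abs_L2:
  assumes "square_integrable f"
  shows "(norm (abs_L2 f))\<^sup>2 = (LINT x|lebesgue. (norm (f x))\<^sup>2)"
  using assms by (simp add: power2_norm_eq_inner inner_L2.abs_eq L2_rel_def)

lemma nn_integral_norm_L2:
  assumes "square_integrable f"
  shows "(\<integral>\<^sup>+x. ennreal ((norm (f x))\<^sup>2) \<partial>lebesgue) = ennreal ((norm (abs_L2 f))\<^sup>2)"
  unfolding norm_abs_L2[OF assms]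
  using assms by (intro nn_integral_eq_integral) (auto simp: square_integrable_def)

lemma abs_L2_diff:
  assumes "square_integrable f" "square_integrable g"
  shows "abs_L2 f - abs_L2 g = abs_L2 (\<lambda>x. f x - g x)"
  using assms by (simp add: minus_L2.abs_eq L2_rel_def)

lemma subspace_vanishes_off: "subspace {u. vanishes_off S u}"
proof -
  have "vanishes_off S (u + v)" if "vanishes_off S u" "vanishes_off S v" for u v :: "'a L2"
    using that by transfer (auto elim: AE_mp)
  moreover have "vanishes_off S (c *\<^sub>R u)" if "vanishes_off S u" for c and u :: "'a L2"
    using that by transfer (auto elim: AE_mp)
  moreover have "vanishes_off S (0 :: 'a L2)"
    by transfer simp
  ultimately show ?thesis by (simp add: subspace_def)
qed

text \<open>The weights \<open>4 ^ n\<close> force the increments of a representing sequence to decay geometrically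
  almost everywhere.\<close>

lemma L2_limit_of_fast_Cauchy:
  fixes u :: "nat \<Rightarrow> 'a::euclidean_space L2"
  assumes fast: "\<And>n. norm (u (Suc n) - u n) \<le> (1/4) ^ n"
    and S: "\<And>n. vanishes_off S (u n)"
  shows "\<exists>v. vanishes_off S v \<and> u \<longlonglongrightarrow> v"
proof -
  define f where "f n = rep_L2 (u n)" for n
  have f: "square_integrable (f n)" "abs_L2 (f n) = u n" for n
    unfolding f_def by (rule rep_L2)+
  have [measurable]: "f n \<in> borel_measurable lebesgue" for n
    using f(1) by (simp add: square_integrable_def)
  define d where "d n x = f (Suc n) x - f n x" for n x
  have d: "square_integrable (d n)" "abs_L2 (d n) = u (Suc n) - u n" for n
    unfolding d_def using f square_integrable_diff abs_L2_diff by metis+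
  have [measurable]: "d n \<in> borel_measurable lebesgue" for n
    using d(1) by (simp add: square_integrable_def)
  have "(\<integral>\<^sup>+x. (\<Sum>n. ennreal (4 ^ n * (norm (d n x))\<^sup>2)) \<partial>lebesgue) =
      (\<Sum>n. \<integral>\<^sup>+x. ennreal (4 ^ n * (norm (d n x))\<^sup>2) \<partial>lebesgue)"
    by (rule nn_integral_suminf) measurable
  \<comment> \<open>Each squared increment has integral at most \<open>16^-n\<close>, so the weights
    still leave the summable majorant \<open>4^-n\<close>.\<close>
  also have "\<dots> \<le> (\<Sum>n. ennreal ((1/4) ^ n))"
  proof (rule suminf_le)
    fix n
    have "(\<integral>\<^sup>+x. ennreal (4 ^ n * (norm (d n x))\<^sup>2) \<partial>lebesgue) = ennreal (4 ^ n) * ennreal ((norm (u (Suc n) - u n))\<^sup>2)"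
      using nn_integral_norm_L2[OF d(1), of n] d(2)[of n] by (simp add: ennreal_mult nn_integral_cmult)
    also have "\<dots> = ennreal (4 ^ n * (norm (u (Suc n) - u n))\<^sup>2)"
      by (simp add: ennreal_mult)
    also have "\<dots> \<le> ennreal (4 ^ n * ((1/4) ^ n)\<^sup>2)"
      using fast by (intro ennreal_leI mult_left_mono power_mono) auto
    also have "4 ^ n * ((1/4) ^ n)\<^sup>2 = (1/4::real) ^ n"
      by (simp add: power2_eq_square power_one_over)
    finally show "(\<integral>\<^sup>+x. ennreal (4 ^ n * (norm (d n x))\<^sup>2) \<partial>lebesgue) \<le> ennreal ((1/4) ^ n)" .
  qed auto
  also have "\<dots> < \<infinity>"
    by (subst suminf_ennreal2) (auto simp: summable_geometric)
  finally have "AE x in lebesgue. (\<Sum>n. ennreal (4 ^ n * (norm (d n x))\<^sup>2)) \<noteq> \<infinity>"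
    by (intro nn_integral_noteq_infinite) auto
  then have conv: "AE x in lebesgue. convergent (\<lambda>n. f n x)"
  proof eventually_elim
    case (elim x)
    have "summable (\<lambda>n. 4 ^ n * (norm (d n x))\<^sup>2)"
      using elim by (intro summable_suminf_not_top) auto
    then have "Bseq (\<lambda>n. 4 ^ n * (norm (d n x))\<^sup>2)"
      by (rule summable_imp_Bseq)
    then obtain B where B: "\<And>n. 4 ^ n * (norm (d n x))\<^sup>2 \<le> B"
      unfolding Bseq_def by (metis abs_le_D1 real_norm_def)
    \<comment> \<open>Bounded terms suffice: weighted squares below \<open>B\<close> give increments
      below \<open>sqrt B * (1/2) ^ n\<close>.\<close>
    have "Cauchy (\<lambda>n. f n x)"
    proof (rule Cauchy_of_geometric_steps)
      fix n
      have B0: "B \<ge> 0" using B[of 0] order_trans[OF zero_le_power2] by auto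
      have "(2 ^ n * norm (d n x))\<^sup>2 \<le> (sqrt B)\<^sup>2"
      proof -
        have "(4::real) ^ n = (2 ^ n)\<^sup>2"
          by (simp add: power2_eq_square flip: power_mult_distrib)
        then show ?thesis using B[of n] B0 by (simp add: power_mult_distrib)
      qed
      then have "2 ^ n * norm (d n x) \<le> sqrt B"
        by (rule power2_le_imp_le) (use B0 in simp)
      then show "norm (f (Suc n) x - f n x) \<le> sqrt B * (1/2) ^ n"
        by (simp add: d_def field_simps)
    qed auto
    then show ?case by (rule Cauchy_convergent)
  qed
  \<comment> \<open>Where the representatives diverge, \<open>lim\<close> takes a default value;
    \<open>g\<close> is still measurable, and the exceptional set is null.\<close>
  define g where "g x = lim (\<lambda>n. f n x)" for x
  have [measurable]: "g \<in> borel_measurable lebesgue"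
    unfolding g_def by (intro borel_measurable_lim_metric) measurable
  have lim: "AE x in lebesgue. (\<lambda>n. f n x) \<longlonglongrightarrow> g x"
    using conv by eventually_elim (simp add: g_def convergent_LIMSEQ_iff)
  \<comment> \<open>Fatou's lemma, with \<open>m\<close> tending to infinity for fixed
    \<open>n\<close>, yields both the square integrability of \<open>g - f n\<close> and the rate of
    convergence. The factor 2 exceeds 4/3, the sum of the geometric tail.\<close>
  have fatou: "(\<integral>\<^sup>+x. ennreal ((norm (g x - f n x))\<^sup>2) \<partial>lebesgue) \<le> ennreal ((2 * (1/4) ^ n)\<^sup>2)" for n
  proof -
    have "(\<integral>\<^sup>+x. ennreal ((norm (g x - f n x))\<^sup>2) \<partial>lebesgue) =
        (\<integral>\<^sup>+x. liminf (\<lambda>m. ennreal ((norm (f m x - f n x))\<^sup>2)) \<partial>lebesgue)"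
    proof (rule nn_integral_cong_AE)
      show "AE x in lebesgue. ennreal ((norm (g x - f n x))\<^sup>2) = liminf (\<lambda>m. ennreal ((norm (f m x - f n x))\<^sup>2))"
        using lim
      proof eventually_elim
        case (elim x)
        then have "(\<lambda>m. ennreal ((norm (f m x - f n x))\<^sup>2)) \<longlonglongrightarrow> ennreal ((norm (g x - f n x))\<^sup>2)"
          by (intro tendsto_intros)
        then show ?case
          using lim_imp_Liminf[OF sequentially_bot] by metis
      qed
    qed
    also have "\<dots> \<le> liminf (\<lambda>m. \<integral>\<^sup>+x. ennreal ((norm (f m x - f n x))\<^sup>2) \<partial>lebesgue)"
      by (rule nn_integral_liminf) measurable
    also have "\<dots> \<le> ennreal ((2 * (1/4) ^ n)\<^sup>2)"
    proof (rule Liminf_le)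
      \<comment> \<open>The subtracted term makes the claim inductive: passing to
        \<open>Suc k\<close> frees \<open>3/2 * (1/4) ^ (n + k)\<close>, which is more than one
        increment uses.\<close>
      have tail: "norm (u (n + k) - u n) \<le> 2 * (1/4) ^ n - 2 * (1/4) ^ (n + k)" for k
      proof (induction k)
        case (Suc k)
        have "norm (u (n + Suc k) - u n) \<le> norm (u (Suc (n + k)) - u (n + k)) + norm (u (n + k) - u n)"
          using norm_triangle_ineq[of "u (Suc (n + k)) - u (n + k)" "u (n + k) - u n"] by simp
        moreover have "(1/4::real) ^ (n + k) \<ge> 0" by simp
        ultimately show ?case
          using fast[of "n + k"] Suc unfolding add_Suc_right power_Suc by linarith
      qed simp
      have "(\<integral>\<^sup>+x. ennreal ((norm (f m x - f n x))\<^sup>2) \<partial>lebesgue) \<le> ennreal ((2 * (1/4) ^ n)\<^sup>2)" if "m \<ge> n" for m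
      proof -
        have "norm (u m - u n) \<le> 2 * (1/4) ^ n"
          using tail[of "m - n"] that by (simp add: order_trans)
        then have "(norm (u m - u n))\<^sup>2 \<le> (2 * (1/4) ^ n)\<^sup>2"
          by (rule power_mono) simp
        moreover have "(\<integral>\<^sup>+x. ennreal ((norm (f m x - f n x))\<^sup>2) \<partial>lebesgue) = ennreal ((norm (u m - u n))\<^sup>2)"
          using nn_integral_norm_L2[OF square_integrable_diff[OF f(1)[of m] f(1)[of n]]]
          by (simp add: f(2) flip: abs_L2_diff[OF f(1) f(1)])
        ultimately show ?thesis by (simp only: ennreal_leI)
      qed
      then show "\<forall>\<^sub>F m in sequentially. (\<integral>\<^sup>+x. ennreal ((norm (f m x - f n x))\<^sup>2) \<partial>lebesgue) \<le> ennreal ((2 * (1/4) ^ n)\<^sup>2)"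
        unfolding eventually_sequentially by blast
    qed auto
    finally show ?thesis .
  qed
  have gf: "square_integrable (\<lambda>x. g x - f n x)" for n
    unfolding square_integrable_def
  proof
    show "integrable lebesgue (\<lambda>x. (norm (g x - f n x))\<^sup>2)"
      using fatou[of n] by (intro integrableI_nonneg) (auto intro: le_less_trans)
  qed measurable
  have g: "square_integrable g"
    using square_integrable_add[OF gf[of 0] f(1)[of 0]] by simp
  have near: "norm (abs_L2 g - u n) \<le> 2 * (1/4) ^ n" for n
  proof (rule power2_le_imp_le)
    have "abs_L2 g - u n = abs_L2 (\<lambda>x. g x - f n x)"
      using abs_L2_diff[OF g f(1)[of n]] f(2) by simp
    then show "(norm (abs_L2 g - u n))\<^sup>2 \<le> (2 * (1/4) ^ n)\<^sup>2"
      using fatou[of n] nn_integral_norm_L2[OF gf[of n]] by simp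
  qed simp
  have "u \<longlonglongrightarrow> abs_L2 g"
  proof (rule LIM_zero_cancel, rule Lim_null_comparison)
    show "\<forall>\<^sub>F n in sequentially. norm (u n - abs_L2 g) \<le> 2 * (1/4) ^ n"
      using near by (simp add: norm_minus_commute)
    show "(\<lambda>n. 2 * (1/4::real) ^ n) \<longlonglongrightarrow> 0"
      by (intro tendsto_mult_right_zero LIMSEQ_realpow_zero) auto
  qed
  moreover have "vanishes_off S (abs_L2 g)"
  proof -
    have "AE x in lebesgue. x \<notin> S \<longrightarrow> f n x = 0" for n
      using S[of n] f(1)[of n] vanishes_off.abs_eq[of "f n" S] by (simp add: f(2) L2_rel_def)
    then have "AE x in lebesgue. \<forall>n. x \<notin> S \<longrightarrow> f n x = 0"
      unfolding AE_all_countable by blast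
    with lim have "AE x in lebesgue. x \<notin> S \<longrightarrow> g x = 0"
      by eventually_elim (auto intro: LIMSEQ_unique)
    then show ?thesis
      using g by (simp add: vanishes_off.abs_eq L2_rel_def)
  qed
  ultimately show ?thesis by blast
qed

lemma complete_vanishes_off: "complete {u :: 'a::euclidean_space L2. vanishes_off S u}"
  unfolding complete_def
proof (intro allI impI, elim conjE)
  fix u :: "nat \<Rightarrow> 'a L2"
  assume u: "\<forall>n. u n \<in> {u. vanishes_off S u}" and "Cauchy u"
  have "\<exists>N. \<forall>m\<ge>N. \<forall>n\<ge>N. dist (u m) (u n) < (1/4) ^ k" for k :: nat
    using metric_CauchyD[OF \<open>Cauchy u\<close>, of "(1/4) ^ k"] by simp
  then obtain N where N: "\<And>k m n. m \<ge> N k \<Longrightarrow> n \<ge> N k \<Longrightarrow> dist (u m) (u n) < (1/4) ^ k"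
    by metis
  \<comment> \<open>Adding up the thresholds makes \<open>r\<close> monotone and at least
    \<open>N k\<close>; the summand \<open>k\<close> makes it strictly increasing.\<close>
  define r where "r k = (\<Sum>i\<le>k. N i) + k" for k
  have r: "strict_mono r"
    unfolding strict_mono_Suc_iff r_def by simp
  have "N k \<le> r k" for k
    unfolding r_def using member_le_sum[of k "{..k}" N] by simp
  moreover have "r k \<le> r (Suc k)" for k
    using r by (simp add: strict_mono_less_eq)
  ultimately have "norm (u (r (Suc k)) - u (r k)) \<le> (1/4) ^ k" for k
    using N[of k "r (Suc k)" "r k"] by (metis dist_norm le_trans less_imp_le)
  then obtain v where v: "vanishes_off S v" "(u \<circ> r) \<longlonglongrightarrow> v"
    using L2_limit_of_fast_Cauchy[of "u \<circ> r" S] u by auto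
  have "u \<longlonglongrightarrow> v"
    using Cauchy_converges_subseq[OF \<open>Cauchy u\<close> r v(2)] .
  with v(1) show "\<exists>l\<in>{u. vanishes_off S u}. u \<longlonglongrightarrow> l" by blast
qed

text \<open>A nonzero vector forces the operator norm of \<open>P\<close> to be at least
  \<open>\<epsilon>\<^sup>2\<close>, which is what makes the gain at least 1.\<close>

lemma L2_on_nontrivial:
  assumes "a < b"
  shows "\<exists>u\<in>L2_on a b. u \<noteq> (0 :: 'a::euclidean_space L2)"
proof -
  obtain e :: 'a where e: "norm e = 1"
    using norm_Basis SOME_Basis by blast
  let ?f = "\<lambda>x. indicator {a..b} x *\<^sub>R e"
  have f: "square_integrable ?f"
    unfolding square_integrable_indicator_iff
    by (simp add: integrable_restrict_space emeasure_restrict_space)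
  have "(norm (abs_L2 ?f))\<^sup>2 = b - a"
  proof -
    have "(norm (?f x))\<^sup>2 = indicator {a..b} x" for x by (simp add: indicator_def e)
    then show ?thesis unfolding norm_abs_L2[OF f] using assms by simp
  qed
  with assms have "abs_L2 ?f \<noteq> 0" by auto
  moreover have "abs_L2 ?f \<in> L2_on a b"
    using f by (simp add: L2_on_def vanishes_off.abs_eq L2_rel_def indicator_def)
  ultimately show ?thesis by blast
qed

section \<open>Symmetric forms and adjoints\<close>

text \<open>A minimising sequence of the energy \<open>\<beta> x x - 2 * \<phi> x\<close> is Cauchy by the parallelogram law.\<close>

lemma symmetric_lax_milgram:
  fixes K :: "'h::real_inner set" and \<beta> :: "'h \<Rightarrow> 'h \<Rightarrow> real"
  assumes K: "subspace K" "complete K"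
    and add: "\<And>x y z. x \<in> K \<Longrightarrow> y \<in> K \<Longrightarrow> z \<in> K \<Longrightarrow> \<beta> (x + y) z = \<beta> x z + \<beta> y z"
    and scale: "\<And>c x y. x \<in> K \<Longrightarrow> y \<in> K \<Longrightarrow> \<beta> (c *\<^sub>R x) y = c * \<beta> x y"
    and sym: "\<And>x y. x \<in> K \<Longrightarrow> y \<in> K \<Longrightarrow> \<beta> x y = \<beta> y x"
    and coercive: "c > 0" "\<And>x. x \<in> K \<Longrightarrow> c * (norm x)\<^sup>2 \<le> \<beta> x x"
    and bounded: "\<And>x y. x \<in> K \<Longrightarrow> y \<in> K \<Longrightarrow> \<beta> x y \<le> C * norm x * norm y"
    and \<phi>_add: "\<And>x y. x \<in> K \<Longrightarrow> y \<in> K \<Longrightarrow> \<phi> (x + y) = \<phi> x + \<phi> y"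
    and \<phi>_scale: "\<And>a x. x \<in> K \<Longrightarrow> \<phi> (a *\<^sub>R x) = a * \<phi> x"
    and \<phi>_bounded: "\<And>x. x \<in> K \<Longrightarrow> \<phi> x \<le> L * norm x"
  shows "\<exists>z\<in>K. \<forall>w\<in>K. \<beta> w z = \<phi> w"
proof -
  note K_intros = subspace_add[OF K(1)] subspace_diff[OF K(1)] subspace_scale[OF K(1)] subspace_0[OF K(1)]
  define F where "F x = \<beta> x x - 2 * \<phi> x" for x
  have add2: "\<beta> z (x + y) = \<beta> z x + \<beta> z y" if "x \<in> K" "y \<in> K" "z \<in> K" for x y z
    using that add[of x y z] sym by (metis K_intros(1))
  have scale2: "\<beta> x (a *\<^sub>R y) = a * \<beta> x y" if "x \<in> K" "y \<in> K" for a x y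
    using that scale[of y x a] sym by (metis K_intros(3))
  have F_shift: "F (x + s *\<^sub>R w) = F x + 2 * s * (\<beta> w x - \<phi> w) + s\<^sup>2 * \<beta> w w"
    if "x \<in> K" "w \<in> K" for x w s
    using that unfolding F_def
    by (simp add: add add2 scale scale2 \<phi>_add \<phi>_scale K_intros sym[of x w] algebra_simps power2_eq_square)
  have F_lower: "F x \<ge> - (L\<^sup>2 / c)" if "x \<in> K" for x
  proof -
    have "F x \<ge> c * (norm x)\<^sup>2 - 2 * (L * norm x)"
      unfolding F_def using coercive(2)[OF that] \<phi>_bounded[OF that] by simp
    also have "c * (norm x)\<^sup>2 - 2 * (L * norm x) = c * (norm x - L / c)\<^sup>2 - L\<^sup>2 / c"
      using coercive(1) by (simp add: field_simps power2_eq_square)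
    finally show ?thesis
      using mult_nonneg_nonneg[OF less_imp_le[OF coercive(1)] zero_le_power2[of "norm x - L / c"]] by linarith
  qed
  define m where "m = (INF x\<in>K. F x)"
  have bdd: "bdd_below (F ` K)"
    using F_lower by (intro bdd_belowI2) auto
  have m_le: "m \<le> F x" if "x \<in> K" for x
    unfolding m_def using that bdd by (intro cINF_lower) auto
  have "\<exists>x\<in>K. F x < m + (1/4) ^ n" for n :: nat
  proof -
    have "m < m + (1/4) ^ n" by simp
    then show ?thesis
      using bdd K_intros(4) unfolding m_def by (subst (asm) cINF_less_iff) auto
  qed
  then obtain X where X: "\<And>n. X n \<in> K" "\<And>n. F (X n) < m + (1/4) ^ n"
    by metis
  \<comment> \<open>The midpoint of \<open>x\<close> and \<open>y\<close> has energy at least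
    \<open>m\<close>; expanding the energy along the segment from \<open>y\<close> turns this into a
    bound on \<open>\<beta> (x - y) (x - y)\<close>.\<close>
  have close: "c * (norm (x - y))\<^sup>2 \<le> 2 * (F x - m) + 2 * (F y - m)" if "x \<in> K" "y \<in> K" for x y
  proof -
    have d: "x - y \<in> K" using that by (intro K_intros)
    have "F x = F (y + 1 *\<^sub>R (x - y))" by simp
    moreover have "F (y + (1/2) *\<^sub>R (x - y)) \<ge> m"
      using that by (intro m_le K_intros)
    ultimately have "\<beta> (x - y) (x - y) \<le> 2 * (F x - m) + 2 * (F y - m)"
      using d that unfolding F_shift[OF that(2) d] by (simp add: power2_eq_square)
    then show ?thesis using coercive(2)[OF d] by linarith
  qed
  have "Cauchy X"
  proof (rule Cauchy_of_geometric_steps)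
    fix n
    have "c * (norm (X (Suc n) - X n))\<^sup>2 \<le> 2 * (1/4) ^ Suc n + 2 * (1/4) ^ n"
      using close[of "X (Suc n)" "X n"] X(1) X(2)[of n] X(2)[of "Suc n"] by fastforce
    also have "\<dots> \<le> 4 * (1/4) ^ n" by simp
    also have "\<dots> = (2 * (1/2) ^ n)\<^sup>2"
    proof -
      have "(1/4::real) ^ n = ((1/2) ^ n)\<^sup>2"
        by (simp add: power2_eq_square flip: power_mult_distrib)
      then show ?thesis by (simp add: power_mult_distrib)
    qed
    finally have "(norm (X (Suc n) - X n))\<^sup>2 \<le> (2 / sqrt c * (1/2) ^ n)\<^sup>2"
      using coercive(1) by (simp add: power_mult_distrib power_divide field_simps)
    then show "norm (X (Suc n) - X n) \<le> 2 / sqrt c * (1/2) ^ n"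
      by (rule power2_le_imp_le) (use coercive(1) in simp)
  qed auto
  then obtain z where z: "z \<in> K" "X \<longlonglongrightarrow> z"
    using completeE[OF K(2), of X] X(1) by auto
  \<comment> \<open>A one-sided estimate replaces continuity of \<open>F\<close>: in the expansion
    of \<open>F (X n)\<close> about \<open>z\<close> the quadratic term is nonnegative, and the
    linear term is bounded below by a multiple of \<open>- norm (X n - z)\<close>.\<close>
  have "F z \<le> m"
  proof (rule LIMSEQ_le)
    show "(\<lambda>n. m + (1/4) ^ n) \<longlonglongrightarrow> m"
      using tendsto_add[OF tendsto_const LIMSEQ_realpow_zero[of "1/4"], of m] by simp
    have n: "(\<lambda>n. norm (X n - z)) \<longlonglongrightarrow> 0"
      using z(2) by (intro tendsto_norm_zero) (simp add: LIM_zero)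
    have "(\<lambda>n. F z - 2 * (C * norm (X n - z) * norm z + L * norm (X n - z))) \<longlonglongrightarrow> F z - 2 * (C * 0 * norm z + L * 0)"
      by (intro tendsto_intros n)
    then show "(\<lambda>n. F z - 2 * (C * norm (X n - z) * norm z + L * norm (X n - z))) \<longlonglongrightarrow> F z" by simp
    have "F z - 2 * (C * norm (X n - z) * norm z + L * norm (X n - z)) \<le> m + (1/4) ^ n" for n
    proof -
      have d1: "X n - z \<in> K" using X(1) z(1) by (intro K_intros)
      note d = d1 K_intros(3)[OF d1, of "- 1"]
      \<comment> \<open>The bound on the form is one-sided, so it is applied to the negated first
        argument.\<close>
      have "- \<beta> (X n - z) z \<le> C * norm (X n - z) * norm z"
        using bounded[OF d(2) z(1)] scale[OF d(1) z(1), of "-1"] by (simp add: norm_minus_commute)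
      moreover have "\<phi> (X n - z) \<le> L * norm (X n - z)" by (rule \<phi>_bounded[OF d(1)])
      moreover have "\<beta> (X n - z) (X n - z) \<ge> 0"
        using coercive(1) coercive(2)[OF d(1)] zero_le_mult_iff by (smt (verit) zero_le_power2)
      moreover have "F (X n) = F z + 2 * 1 * (\<beta> (X n - z) z - \<phi> (X n - z)) + 1\<^sup>2 * \<beta> (X n - z) (X n - z)"
        using F_shift[OF z(1) d(1), of 1] by simp
      ultimately show ?thesis using X(2)[of n] by simp
    qed
    then show "\<exists>N. \<forall>n\<ge>N. F z - 2 * (C * norm (X n - z) * norm z + L * norm (X n - z)) \<le> m + (1/4) ^ n"
      by blast
  qed
  then have min: "F z \<le> F x" if "x \<in> K" for x
    using m_le[OF that] by simp
  show ?thesis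
  proof (intro bexI[OF _ z(1)] ballI)
    fix w assume w: "w \<in> K"
    let ?d = "\<beta> w z - \<phi> w" and ?b = "\<beta> w w"
    have b: "?b \<ge> 0"
      using coercive(1) coercive(2)[OF w] by (smt (verit) zero_le_power2 zero_le_mult_iff)
    have "0 \<le> 2 * s * ?d + s\<^sup>2 * ?b" for s
      using min[of "z + s *\<^sub>R w"] F_shift[OF z(1) w, of s] z(1) w by (simp add: K_intros)
    \<comment> \<open>The vertex of the parabola is at \<open>- ?d / ?b\<close>; taking
      \<open>1 + ?b\<close> instead keeps the denominator positive when
      \<open>?b = 0\<close>.\<close>
    from this[of "- ?d / (1 + ?b)"] have "0 \<le> 2 * (- ?d / (1 + ?b)) * ?d + (- ?d / (1 + ?b))\<^sup>2 * (1 + ?b)"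
      using b by (smt (verit) mult_left_mono zero_le_power2)
    also have "\<dots> = - (?d\<^sup>2 / (1 + ?b))"
      using b by (simp add: power_divide divide_simps) (simp add: power2_eq_square algebra_simps)
    finally have "?d\<^sup>2 / (1 + ?b) \<le> 0" by simp
    moreover have "0 < ?d\<^sup>2 / (1 + ?b)" if "\<beta> w z \<noteq> \<phi> w"
      by (rule divide_pos_pos) (use that b in auto)
    ultimately show "\<beta> w z = \<phi> w" by fastforce
  qed
qed

section \<open>Bounded operators on a subspace and their adjoints\<close>

lemma bounded_linear_op_onD:
  assumes "bounded_linear_op_on H T"
  shows "x \<in> H \<Longrightarrow> T x \<in> H"
    and "x \<in> H \<Longrightarrow> y \<in> H \<Longrightarrow> T (x + y) = T x + T y"
    and "x \<in> H \<Longrightarrow> T (c *\<^sub>R x) = c *\<^sub>R T x"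
  using assms by (auto simp: bounded_linear_op_on_def)

lemma bounded_linear_op_on_diff:
  assumes "bounded_linear_op_on H T" "subspace H" "x \<in> H" "y \<in> H"
  shows "T (x - y) = T x - T y"
  using bounded_linear_op_onD(2)[OF assms(1), of x "- 1 *\<^sub>R y"] bounded_linear_op_onD(3)[OF assms(1), of y "- 1"]
    subspace_scale[OF assms(2,4), of "- 1"] assms(3,4) by simp

lemma bounded_linear_op_on_bound:
  assumes "bounded_linear_op_on H T"
  shows "\<exists>C>0. \<forall>x\<in>H. norm (T x) \<le> C * norm x"
proof -
  obtain C where C: "\<forall>x\<in>H. norm (T x) \<le> C * norm x"
    using assms by (auto simp: bounded_linear_op_on_def)
  have "norm (T x) \<le> max C 1 * norm x" if "x \<in> H" for x
    using bspec[OF C that] mult_right_mono[of C "max C 1" "norm x"] by simp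
  then show ?thesis by (intro exI[of _ "max C 1"]) simp
qed

text \<open>One form serves the shift \<open>\<A> - \<omega> T\<close>, the operator
  \<open>\<mu> T - \<A>\<close> of condition (2), and, with \<open>b = 0\<close>, the exponential
  rescaling of a semigroup.\<close>

lemma bounded_linear_op_on_combine:
  assumes S: "subspace H" and T: "bounded_linear_op_on H T" and U: "bounded_linear_op_on H U"
  shows "bounded_linear_op_on H (\<lambda>v. a *\<^sub>R T v + b *\<^sub>R U v)"
proof -
  obtain C where C: "C > 0" "\<forall>x\<in>H. norm (T x) \<le> C * norm x"
    using bounded_linear_op_on_bound[OF T] by blast
  obtain K where K: "K > 0" "\<forall>x\<in>H. norm (U x) \<le> K * norm x"
    using bounded_linear_op_on_bound[OF U] by blast
  have "norm (a *\<^sub>R T v + b *\<^sub>R U v) \<le> (\<bar>a\<bar> * C + \<bar>b\<bar> * K) * norm v" if "v \<in> H" for v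
  proof -
    have "norm (a *\<^sub>R T v + b *\<^sub>R U v) \<le> \<bar>a\<bar> * norm (T v) + \<bar>b\<bar> * norm (U v)"
      using norm_triangle_ineq[of "a *\<^sub>R T v" "b *\<^sub>R U v"] by simp
    also have "\<dots> \<le> \<bar>a\<bar> * (C * norm v) + \<bar>b\<bar> * (K * norm v)"
      using C K that by (intro add_mono mult_left_mono) auto
    finally show ?thesis by (simp add: algebra_simps)
  qed
  then show ?thesis
    using bounded_linear_op_onD[OF T] bounded_linear_op_onD[OF U] S
    unfolding bounded_linear_op_on_def
    by (auto simp: scaleR_add_right mult.commute intro!: subspace_add subspace_scale
        exI[of _ "\<bar>a\<bar> * C + \<bar>b\<bar> * K"])
qed

text \<open>Riesz representation is \<open>symmetric_lax_milgram\<close> for the inner product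
  itself; testing with the difference of two representing vectors gives the uniqueness that the
  description in \<open>adjoint_on\<close> requires.\<close>

lemma
  assumes S: "subspace H" and H: "complete H" and T: "bounded_linear_op_on H T" and y: "y \<in> H"
  shows adjoint_on_in: "adjoint_on H T y \<in> H"
    and adjoint_on_inner: "x \<in> H \<Longrightarrow> T x \<bullet> y = x \<bullet> adjoint_on H T y"
proof -
  obtain C where C: "C > 0" "\<forall>x\<in>H. norm (T x) \<le> C * norm x"
    using bounded_linear_op_on_bound[OF T] by blast
  have "\<exists>z\<in>H. \<forall>w\<in>H. w \<bullet> z = T w \<bullet> y"
  proof (rule symmetric_lax_milgram[OF S H, where c = 1 and C = 1])
    fix x assume x: "x \<in> H"
    have "T x \<bullet> y \<le> norm (T x) * norm y" by (rule norm_cauchy_schwarz)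
    also have "\<dots> \<le> (C * norm x) * norm y" using C x by (intro mult_right_mono) auto
    finally show "T x \<bullet> y \<le> (C * norm y) * norm x" by (simp add: ac_simps)
  qed (auto simp: bounded_linear_op_onD[OF T] algebra_simps inner_commute power2_norm_eq_inner norm_cauchy_schwarz)
  then obtain z where z: "z \<in> H" "\<And>w. w \<in> H \<Longrightarrow> T w \<bullet> y = w \<bullet> z" by metis
  have "z' = z" if "z' \<in> H" "\<forall>x\<in>H. T x \<bullet> y = x \<bullet> z'" for z'
  proof -
    have "(z' - z) \<bullet> z' = (z' - z) \<bullet> z"
      using that z subspace_diff[OF S that(1) z(1)] by metis
    then have "(z' - z) \<bullet> (z' - z) = 0" by (simp add: inner_diff_right)
    then show ?thesis by simp
  qed
  then have "adjoint_on H T y = z"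
    unfolding adjoint_on_def using z by (intro the_equality) auto
  with z show "adjoint_on H T y \<in> H" "x \<in> H \<Longrightarrow> T x \<bullet> y = x \<bullet> adjoint_on H T y" by auto
qed

lemma adjoint_on_unique:
  assumes S: "subspace H" and "complete H" "bounded_linear_op_on H T" "y \<in> H"
    and "z \<in> H" "\<And>x. x \<in> H \<Longrightarrow> T x \<bullet> y = x \<bullet> z"
  shows "adjoint_on H T y = z"
proof -
  let ?d = "adjoint_on H T y - z"
  have "?d \<in> H" using assms adjoint_on_in by (intro subspace_diff[OF S]) auto
  then have "?d \<bullet> adjoint_on H T y = ?d \<bullet> z"
    using adjoint_on_inner[OF assms(1-4), of ?d] assms(6) by auto
  then have "?d \<bullet> ?d = 0" by (simp add: inner_diff_right)
  then show ?thesis by simp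
qed

lemma adjoint_on_add:
  assumes "subspace H" "complete H" "bounded_linear_op_on H T" "x \<in> H" "y \<in> H"
  shows "adjoint_on H T (x + y) = adjoint_on H T x + adjoint_on H T y"
  using assms adjoint_on_inner[OF assms(1-3)] adjoint_on_in[OF assms(1-3)]
  by (intro adjoint_on_unique subspace_add) (auto simp: inner_add_right)

lemma adjoint_on_scaleR:
  assumes "subspace H" "complete H" "bounded_linear_op_on H T" "x \<in> H"
  shows "adjoint_on H T (c *\<^sub>R x) = c *\<^sub>R adjoint_on H T x"
  using assms adjoint_on_inner[OF assms(1-3)] adjoint_on_in[OF assms(1-3)]
  by (intro adjoint_on_unique subspace_scale) auto

lemma adjoint_on_bound:
  assumes "subspace H" "complete H" "bounded_linear_op_on H T" "x \<in> H"
    and C: "\<And>x. x \<in> H \<Longrightarrow> norm (T x) \<le> C * norm x"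
  shows "norm (adjoint_on H T x) \<le> C * norm x"
proof -
  let ?z = "adjoint_on H T x"
  have z: "?z \<in> H" using assms adjoint_on_in by auto
  have "(norm ?z)\<^sup>2 = T ?z \<bullet> x"
    using adjoint_on_inner[OF assms(1-4) z] by (simp add: power2_norm_eq_inner)
  also have "\<dots> \<le> norm (T ?z) * norm x" by (rule norm_cauchy_schwarz)
  also have "\<dots> \<le> (C * norm ?z) * norm x" using C[OF z] by (intro mult_right_mono) auto
  finally have *: "norm ?z * norm ?z \<le> norm ?z * (C * norm x)"
    by (simp add: power2_eq_square ac_simps)
  show ?thesis
  proof (cases "?z = 0")
    case True
    then show ?thesis using C[OF assms(4)] order_trans[OF norm_ge_zero] by simp
  next
    case False
    with * show ?thesis by simp
  qed
qed

lemma adjoint_on_combine: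
  assumes "subspace H" "complete H" "bounded_linear_op_on H T" "bounded_linear_op_on H U" "x \<in> H"
  shows "adjoint_on H (\<lambda>v. a *\<^sub>R T v + b *\<^sub>R U v) x = a *\<^sub>R adjoint_on H T x + b *\<^sub>R adjoint_on H U x"
  using assms adjoint_on_in
  by (intro adjoint_on_unique subspace_add subspace_scale bounded_linear_op_on_combine)
    (auto simp: inner_add_left inner_add_right adjoint_on_inner[OF assms(1,2,3,5)]
      adjoint_on_inner[OF assms(1,2,4,5)])

text \<open>The form \<open>\<langle>B\<^sup>* x, B\<^sup>* y\<rangle>\<close> is coercive, so \<open>B B\<^sup>*\<close> is already onto.\<close>

lemma surj_if_adjoint_bounded_below:
  assumes S: "subspace H" and H: "complete H" and B: "bounded_linear_op_on H B"
    and \<epsilon>: "\<epsilon> > 0" and below: "\<And>v. v \<in> H \<Longrightarrow> \<epsilon> * norm v \<le> norm (adjoint_on H B v)"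
    and f: "f \<in> H"
  shows "\<exists>v\<in>H. B v = f"
proof -
  let ?B' = "adjoint_on H B"
  obtain C where C: "C > 0" "\<forall>x\<in>H. norm (B x) \<le> C * norm x"
    using bounded_linear_op_on_bound[OF B] by blast
  have "\<exists>z\<in>H. \<forall>w\<in>H. ?B' w \<bullet> ?B' z = w \<bullet> f"
  proof (rule symmetric_lax_milgram[OF S H, where c = "\<epsilon>\<^sup>2" and C = "C * C" and L = "norm f"])
    fix x y assume x: "x \<in> H" and y: "y \<in> H"
    have "?B' x \<bullet> ?B' y \<le> norm (?B' x) * norm (?B' y)" by (rule norm_cauchy_schwarz)
    also have "\<dots> \<le> (C * norm x) * (C * norm y)"
      using C x y by (intro mult_mono adjoint_on_bound[OF S H B]) auto
    finally show "?B' x \<bullet> ?B' y \<le> C * C * norm x * norm y" by (simp add: ac_simps)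
  next
    fix x assume "x \<in> H"
    then have "(\<epsilon> * norm x)\<^sup>2 \<le> (norm (?B' x))\<^sup>2"
      using \<epsilon> below by (intro power_mono) auto
    then show "\<epsilon>\<^sup>2 * (norm x)\<^sup>2 \<le> ?B' x \<bullet> ?B' x"
      by (simp add: power_mult_distrib power2_norm_eq_inner)
  next
    fix x show "x \<bullet> f \<le> norm f * norm x"
      using norm_cauchy_schwarz[of x f] by (simp add: mult.commute)
  qed (use \<epsilon> in \<open>auto simp: adjoint_on_add[OF S H B] adjoint_on_scaleR[OF S H B] inner_commute inner_add_left inner_add_right\<close>)
  then obtain z where z: "z \<in> H" "\<And>w. w \<in> H \<Longrightarrow> ?B' w \<bullet> ?B' z = w \<bullet> f" by auto
  have z': "?B' z \<in> H" using adjoint_on_in[OF S H B z(1)] .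
  \<comment> \<open>The residual lies in \<open>H\<close>, so the weak equation may be tested with
    it, which makes its norm vanish.\<close>
  have d: "B (?B' z) - f \<in> H"
    using z' f bounded_linear_op_onD(1)[OF B] by (intro subspace_diff[OF S]) auto
  have "B (?B' z) \<bullet> (B (?B' z) - f) = f \<bullet> (B (?B' z) - f)"
    using adjoint_on_inner[OF S H B d z'] z(2)[OF d] by (simp add: inner_commute)
  then have "(B (?B' z) - f) \<bullet> (B (?B' z) - f) = 0" by (simp add: inner_diff_left)
  then have "B (?B' z) = f" by simp
  with z' show ?thesis by blast
qed

section \<open>The implicit Euler scheme\<close>

text \<open>Rounding down covers every \<open>t \<ge> 0\<close> but is inexact: refining the grid or
  adding two times can cost one surplus step, which is of order \<open>2^-k\<close> on the domain of
  \<open>A\<close>.\<close>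

definition dyadic_steps :: "nat \<Rightarrow> real \<Rightarrow> nat" where
  "dyadic_steps k t = nat \<lfloor>t * 2 ^ k\<rfloor>"

lemma dyadic_steps_bounds:
  assumes "t \<ge> 0"
  shows "real (dyadic_steps k t) * (1/2) ^ k \<le> t" "t - (1/2) ^ k \<le> real (dyadic_steps k t) * (1/2) ^ k"
proof -
  have "0 \<le> t * 2 ^ k" using assms by simp
  then have 1: "real (dyadic_steps k t) \<le> t * 2 ^ k" "t * 2 ^ k - 1 \<le> real (dyadic_steps k t)"
    unfolding dyadic_steps_def by linarith+
  from 1(1) show "real (dyadic_steps k t) * (1/2) ^ k \<le> t"
    by (simp add: power_one_over field_simps)
  from mult_right_mono[OF 1(2), of "(1/2) ^ k"]
  show "t - (1/2) ^ k \<le> real (dyadic_steps k t) * (1/2) ^ k"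
    by (simp add: left_diff_distrib power_one_over diff_divide_distrib)
qed

lemma dyadic_steps_tendsto:
  assumes "t \<ge> 0"
  shows "(\<lambda>k. real (dyadic_steps k t) * (1/2) ^ k) \<longlonglongrightarrow> t"
proof (rule tendsto_sandwich)
  show "(\<lambda>k. t - (1/2) ^ k) \<longlonglongrightarrow> t"
    by (rule tendsto_eq_intros LIMSEQ_realpow_zero refl)+ auto
qed (use dyadic_steps_bounds[OF assms] in auto)

lemma dyadic_steps_Suc:
  assumes "t \<ge> 0"
  shows "dyadic_steps (Suc k) t \<in> {2 * dyadic_steps k t, Suc (2 * dyadic_steps k t)}"
proof -
  have "0 \<le> t * 2 ^ k" using assms by simp
  then show ?thesis
    unfolding dyadic_steps_def power_Suc insert_iff
    by (simp add: mult.left_commute[of t]) linarith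
qed

lemma dyadic_steps_add:
  assumes "t \<ge> 0" "s \<ge> 0"
  shows "dyadic_steps k (t + s) \<in> {dyadic_steps k t + dyadic_steps k s, Suc (dyadic_steps k t + dyadic_steps k s)}"
proof -
  have "0 \<le> t * 2 ^ k" "0 \<le> s * 2 ^ k" using assms by simp_all
  then show ?thesis
    unfolding dyadic_steps_def distrib_right insert_iff
    by simp linarith
qed

text \<open>The Hille-Yosida setting with growth rate 0: \<open>J h\<close> is the two-sided inverse
  of \<open>I - h A\<close>, and all powers share one bound \<open>M\<close>. No second inner
  product appears.\<close>

locale resolvent_family =
  fixes H D :: "'h::real_inner set" and A :: "'h \<Rightarrow> 'h" and J :: "real \<Rightarrow> 'h \<Rightarrow> 'h" and M :: real
  assumes subspace_H: "subspace H" and complete_H: "complete H"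
    and subspace_D: "subspace D" and D_subset: "D \<subseteq> H"
    and A_in: "x \<in> D \<Longrightarrow> A x \<in> H"
    and A_add: "x \<in> D \<Longrightarrow> y \<in> D \<Longrightarrow> A (x + y) = A x + A y"
    and A_scaleR: "x \<in> D \<Longrightarrow> A (c *\<^sub>R x) = c *\<^sub>R A x"
    and J_in_D: "h > 0 \<Longrightarrow> x \<in> H \<Longrightarrow> J h x \<in> D"
    and J_right: "h > 0 \<Longrightarrow> x \<in> H \<Longrightarrow> J h x - h *\<^sub>R A (J h x) = x"
    and J_left: "h > 0 \<Longrightarrow> x \<in> D \<Longrightarrow> J h (x - h *\<^sub>R A x) = x"
    and M_ge_1: "M \<ge> 1"
    and J_power_bound: "h > 0 \<Longrightarrow> x \<in> H \<Longrightarrow> norm ((J h ^^ n) x) \<le> M * norm x"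
    and dense: "x \<in> H \<Longrightarrow> e > 0 \<Longrightarrow> \<exists>y\<in>D. norm (x - y) < e"
begin

lemmas H_intros = subspace_add[OF subspace_H] subspace_diff[OF subspace_H] subspace_scale[OF subspace_H]
lemmas D_intros = subspace_add[OF subspace_D] subspace_diff[OF subspace_D] subspace_scale[OF subspace_D]

lemma D_in_H: "x \<in> D \<Longrightarrow> x \<in> H"
  using D_subset by auto

lemma J_in: "h > 0 \<Longrightarrow> x \<in> H \<Longrightarrow> J h x \<in> H"
  using J_in_D D_subset by blast

lemma A_diff: "x \<in> D \<Longrightarrow> y \<in> D \<Longrightarrow> A (x - y) = A x - A y"
  using A_add[of x "- 1 *\<^sub>R y"] A_scaleR[of y "- 1"] D_intros(3)[of y "- 1"] by simp

lemma J_unique: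
  assumes "h > 0" "y \<in> D" "y - h *\<^sub>R A y = x"
  shows "J h x = y"
  using J_left assms by blast

lemma J_add: "h > 0 \<Longrightarrow> x \<in> H \<Longrightarrow> y \<in> H \<Longrightarrow> J h (x + y) = J h x + J h y"
proof (rule J_unique)
  assume h: "h > 0" "x \<in> H" "y \<in> H"
  have "J h x + J h y - h *\<^sub>R A (J h x + J h y) = (J h x - h *\<^sub>R A (J h x)) + (J h y - h *\<^sub>R A (J h y))"
    using h by (simp add: A_add J_in_D scaleR_add_right)
  with h show "J h x + J h y - h *\<^sub>R A (J h x + J h y) = x + y"
    by (simp only: J_right)
qed (auto intro: D_intros J_in_D)

lemma J_scaleR: "h > 0 \<Longrightarrow> x \<in> H \<Longrightarrow> J h (c *\<^sub>R x) = c *\<^sub>R J h x"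
proof (rule J_unique)
  assume h: "h > 0" "x \<in> H"
  have "c *\<^sub>R J h x - h *\<^sub>R A (c *\<^sub>R J h x) = c *\<^sub>R (J h x - h *\<^sub>R A (J h x))"
    using h by (simp add: A_scaleR J_in_D scaleR_diff_right mult.commute)
  with h show "c *\<^sub>R J h x - h *\<^sub>R A (c *\<^sub>R J h x) = c *\<^sub>R x"
    by (simp add: J_right)
qed (auto intro: D_intros J_in_D)

lemma J_diff: "h > 0 \<Longrightarrow> x \<in> H \<Longrightarrow> y \<in> H \<Longrightarrow> J h (x - y) = J h x - J h y"
  using J_add[of h x "- 1 *\<^sub>R y"] J_scaleR[of h y "- 1"] H_intros(3)[of y "- 1"] by simp

text \<open>\<open>J_left\<close> and \<open>J_right\<close> give two expressions for the same
  \<open>x\<close>, and they differ only in the order of \<open>A\<close> and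
  \<open>J h\<close>.\<close>

lemma J_A:
  assumes "h > 0" "x \<in> D"
  shows "A (J h x) = J h (A x)"
proof -
  have "J h x - h *\<^sub>R J h (A x) = J h x - h *\<^sub>R A (J h x)"
    using J_left[OF assms] J_right[of h x] assms
    by (simp add: J_diff J_scaleR D_in_H A_in H_intros)
  then show ?thesis using assms by simp
qed

lemma J_minus_self: "h > 0 \<Longrightarrow> x \<in> D \<Longrightarrow> J h x - x = h *\<^sub>R J h (A x)"
  using J_right[of h x] by (simp add: J_A[symmetric] D_in_H algebra_simps)

text \<open>Since \<open>J h\<close> commutes with \<open>A\<close>, the vector
  \<open>J h (J k x)\<close> solves the equation that determines \<open>J k (J h x)\<close>.\<close>

lemma J_commute:
  assumes "h > 0" "k > 0" "x \<in> H"
  shows "J h (J k x) = J k (J h x)"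
proof (rule sym, rule J_unique)
  have "J h (J k x - k *\<^sub>R A (J k x)) = J h x"
    using assms by (simp add: J_right)
  then show "J h (J k x) - k *\<^sub>R A (J h (J k x)) = J h x"
    using assms by (simp add: J_A J_diff J_scaleR J_in J_in_D A_in H_intros)
qed (use assms in \<open>auto intro: J_in_D J_in\<close>)

lemma pow_in: "h > 0 \<Longrightarrow> x \<in> H \<Longrightarrow> (J h ^^ n) x \<in> H"
  by (induction n) (auto intro: J_in)

lemma pow_in_D: "h > 0 \<Longrightarrow> x \<in> D \<Longrightarrow> (J h ^^ n) x \<in> D"
  by (induction n) (auto intro: J_in_D D_in_H)

lemma pow_add: "h > 0 \<Longrightarrow> x \<in> H \<Longrightarrow> y \<in> H \<Longrightarrow> (J h ^^ n) (x + y) = (J h ^^ n) x + (J h ^^ n) y"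
  by (induction n) (auto simp: J_add pow_in)

lemma pow_diff: "h > 0 \<Longrightarrow> x \<in> H \<Longrightarrow> y \<in> H \<Longrightarrow> (J h ^^ n) (x - y) = (J h ^^ n) x - (J h ^^ n) y"
  by (induction n) (auto simp: J_diff pow_in)

lemma pow_scaleR: "h > 0 \<Longrightarrow> x \<in> H \<Longrightarrow> (J h ^^ n) (c *\<^sub>R x) = c *\<^sub>R (J h ^^ n) x"
  by (induction n) (auto simp: J_scaleR pow_in)

lemma pow_J: "h > 0 \<Longrightarrow> k > 0 \<Longrightarrow> x \<in> H \<Longrightarrow> J k ((J h ^^ n) x) = (J h ^^ n) (J k x)"
  by (induction n) (auto simp: J_commute[of k h] pow_in)

lemma pow_bound: "h > 0 \<Longrightarrow> x \<in> H \<Longrightarrow> norm x \<le> c \<Longrightarrow> norm ((J h ^^ n) x) \<le> M * c"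
  using J_power_bound[of h x n] M_ge_1 mult_left_mono[of "norm x" c M] by linarith

lemma J_bound: "h > 0 \<Longrightarrow> x \<in> H \<Longrightarrow> norm (J h x) \<le> M * norm x"
  using J_power_bound[of h x 1] by simp

text \<open>The discrete counterpart of \<open>d/dt S(t) x = S(t) A x\<close>. With \<open>A\<close>
  moved inside the power, the uniform bound \<open>M\<close> applies.\<close>

lemma pow_Suc_diff:
  assumes "h > 0" "x \<in> D"
  shows "(J h ^^ Suc n) x - (J h ^^ n) x = h *\<^sub>R (J h ^^ Suc n) (A x)"
proof -
  have "(J h ^^ Suc n) x - (J h ^^ n) x = (J h ^^ n) (J h x - x)"
    using assms by (simp add: funpow_swap1 pow_diff J_in D_in_H)
  then show ?thesis
    using assms by (simp add: J_minus_self pow_scaleR funpow_swap1 J_in A_in)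
qed

lemma norm_pow_Suc_diff:
  assumes "h > 0" "x \<in> D"
  shows "norm ((J h ^^ Suc n) x - (J h ^^ n) x) \<le> h * (M * norm (A x))"
  unfolding pow_Suc_diff[OF assms]
  using assms J_power_bound[of h "A x" "Suc n"] by (auto simp: A_in intro!: mult_left_mono)

lemma norm_pow_minus_self:
  assumes "h > 0" "x \<in> D"
  shows "norm ((J h ^^ n) x - x) \<le> real n * h * (M * norm (A x))"
proof (induction n)
  case (Suc n)
  have "norm ((J h ^^ Suc n) x - x) \<le> norm ((J h ^^ Suc n) x - (J h ^^ n) x) + norm ((J h ^^ n) x - x)"
    using norm_triangle_ineq[of "(J h ^^ Suc n) x - (J h ^^ n) x" "(J h ^^ n) x - x"] by simp
  with Suc norm_pow_Suc_diff[OF assms, of n] show ?case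
    by (simp add: algebra_simps)
qed simp

text \<open>A discrete Taylor estimate: each increment is compared with
  \<open>h *\<^sub>R A x\<close> by applying \<open>norm_pow_minus_self\<close> to
  \<open>A x\<close>. The bound involves the step only through the elapsed time
  \<open>n * h\<close>, so it survives the limit.\<close>

lemma norm_pow_second_order:
  assumes "h > 0" "x \<in> D" "A x \<in> D"
  shows "norm ((J h ^^ n) x - x - (real n * h) *\<^sub>R A x) \<le> (real n * h)\<^sup>2 * (M * norm (A (A x)))"
proof (induction n)
  case (Suc n)
  let ?C = "M * norm (A (A x))"
  have C: "?C \<ge> 0" using M_ge_1 by simp
  have "(J h ^^ Suc n) x - x - (real (Suc n) * h) *\<^sub>R A x =
      ((J h ^^ Suc n) x - (J h ^^ n) x) - h *\<^sub>R A x + ((J h ^^ n) x - x - (real n * h) *\<^sub>R A x)"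
    by (simp add: algebra_simps)
  also have "\<dots> = h *\<^sub>R ((J h ^^ Suc n) (A x) - A x) + ((J h ^^ n) x - x - (real n * h) *\<^sub>R A x)"
    unfolding pow_Suc_diff[OF assms(1,2)] by (simp add: algebra_simps)
  also have "norm \<dots> \<le> norm (h *\<^sub>R ((J h ^^ Suc n) (A x) - A x)) + norm ((J h ^^ n) x - x - (real n * h) *\<^sub>R A x)"
    by (rule norm_triangle_ineq)
  also have "norm (h *\<^sub>R ((J h ^^ Suc n) (A x) - A x)) = h * norm ((J h ^^ Suc n) (A x) - A x)"
    using assms by simp
  also have "\<dots> \<le> h * (real (Suc n) * h * ?C)"
    using assms norm_pow_minus_self[of h "A x" "Suc n"] by (intro mult_left_mono) auto
  finally have "norm ((J h ^^ Suc n) x - x - (real (Suc n) * h) *\<^sub>R A x) \<le>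
      h * (real (Suc n) * h * ?C) + (real n * h)\<^sup>2 * ?C"
    using Suc by linarith
  also have "\<dots> = (real (Suc n) + (real n)\<^sup>2) * (h\<^sup>2 * ?C)"
    by (simp add: algebra_simps power2_eq_square)
  also have "\<dots> \<le> (real (Suc n))\<^sup>2 * (h\<^sup>2 * ?C)"
  proof (rule mult_right_mono)
    show "real (Suc n) + (real n)\<^sup>2 \<le> (real (Suc n))\<^sup>2"
      by (simp add: power2_eq_square algebra_simps)
  qed (use C in simp)
  finally show ?case by (simp add: power_mult_distrib mult.assoc)
qed simp

text \<open>Because \<open>(I - h A)^2 = (I - 2 h A) + h^2 A^2\<close>, the difference of the two
  inverses is \<open>h^2 A^2\<close> multiplied by both of them.\<close>

lemma J_double_step:
  assumes h: "h > 0" and x: "x \<in> D" "A x \<in> D"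
  shows "J (2 * h) x - J h (J h x) = h\<^sup>2 *\<^sub>R J (2 * h) (J h (J h (A (A x))))"
proof -
  define y where "y = x - h *\<^sub>R A x"
  define w where "w = y - h *\<^sub>R A y"
  have y: "y \<in> D" unfolding y_def using x by (intro D_intros)
  have w: "w \<in> H" unfolding w_def using y by (intro H_intros A_in D_in_H)
  have v: "x - (2 * h) *\<^sub>R A x \<in> H" using x by (intro H_intros A_in D_in_H)
  have "A y = A x - h *\<^sub>R A (A x)"
    unfolding y_def using x by (simp add: A_diff A_scaleR D_intros)
  then have wv: "w - (x - (2 * h) *\<^sub>R A x) = h\<^sup>2 *\<^sub>R A (A x)"
    unfolding w_def \<open>A y = _\<close> unfolding y_def by (simp add: algebra_simps power2_eq_square flip: scaleR_add_left)
  have "J h (J h w) = x"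
    unfolding w_def J_left[OF h y] unfolding y_def using J_left h x by auto
  then have "J (2 * h) x = J h (J h (J (2 * h) w))"
    using h w by (metis J_commute J_in mult_pos_pos zero_less_numeral)
  moreover have "J h (J h x) = J h (J h (J (2 * h) (x - (2 * h) *\<^sub>R A x)))"
    using h x J_left[of "2 * h" x] by simp
  ultimately have "J (2 * h) x - J h (J h x) = J h (J h (J (2 * h) (w - (x - (2 * h) *\<^sub>R A x))))"
    using h w v by (simp add: J_diff J_in)
  then show ?thesis
    unfolding wv using h x by (simp add: J_scaleR J_in A_in J_commute)
qed

lemma norm_pow_double_step:
  assumes h: "h > 0" and x: "x \<in> D" "A x \<in> D"
  shows "norm ((J (2 * h) ^^ n) x - (J h ^^ (2 * n)) x) \<le> real n * (h\<^sup>2 * (M * (M * norm (A (A x)))))"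
proof -
  have h2: "2 * h > 0" using h by simp
  \<comment> \<open>The leading power \<open>J h ^^ m\<close> is what keeps the constant fixed. The
    induction step puts two factors \<open>J h\<close> in front of the previous difference; they are
    absorbed into this power and so cost \<open>M\<close> once, not once per step.\<close>
  have *: "norm ((J h ^^ m) ((J (2 * h) ^^ n) x - (J h ^^ (2 * n)) x)) \<le>
      real n * (h\<^sup>2 * (M * (M * norm (A (A x)))))" (is "_ \<le> real n * ?K") for m
  proof (induction n arbitrary: m)
    case (Suc n)
    let ?a = "J (2 * h)" and ?b = "J h"
    have xH: "x \<in> H" using x D_in_H by auto
    have bb: "(J h ^^ (2 * Suc n)) x = ?b (?b ((J h ^^ (2 * n)) x))" by simp
    have b2: "(?b ^^ m) (?b (?b y)) = (?b ^^ (m + 2)) y" for y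
      by (simp add: funpow_swap1)
    have comm: "(?a ^^ n) (?b (?b x)) = ?b (?b ((?a ^^ n) x))"
      using h h2 xH by (simp add: pow_J J_in)
    have "(?a ^^ Suc n) x - (?b ^^ (2 * Suc n)) x
        = (?a ^^ n) (?a x - ?b (?b x)) + ?b (?b ((?a ^^ n) x - (?b ^^ (2 * n)) x))"
      unfolding bb using h h2 xH
      by (simp add: funpow_swap1 pow_diff J_diff J_in pow_in comm)
    moreover have "(?a ^^ n) (?a x - ?b (?b x)) = h\<^sup>2 *\<^sub>R ?b (?b ((?a ^^ Suc n) (A (A x))))"
      unfolding J_double_step[OF h x] using h h2 x
      by (simp add: pow_scaleR J_in A_in pow_J funpow_swap1 J_commute)
    ultimately have "(J h ^^ m) ((?a ^^ Suc n) x - (?b ^^ (2 * Suc n)) x)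
        = h\<^sup>2 *\<^sub>R (?b ^^ (m + 2)) ((?a ^^ Suc n) (A (A x)))
          + (?b ^^ (m + 2)) ((?a ^^ n) x - (?b ^^ (2 * n)) x)"
      using h h2 x xH
      by (simp add: pow_add pow_scaleR J_in A_in pow_in H_intros b2 del: funpow.simps(2))
    also have "norm \<dots> \<le> ?K + real n * ?K"
    proof (rule order_trans[OF norm_triangle_ineq add_mono])
      have "norm ((?b ^^ (m + 2)) ((?a ^^ Suc n) (A (A x)))) \<le> M * (M * norm (A (A x)))"
        using h h2 x by (intro pow_bound J_power_bound pow_in A_in)
      then show "norm (h\<^sup>2 *\<^sub>R (?b ^^ (m + 2)) ((?a ^^ Suc n) (A (A x)))) \<le> ?K"
        by (simp add: mult_left_mono)
    qed (rule Suc.IH)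
    finally show ?case by (simp add: algebra_simps)
  qed (use h pow_diff[of h 0 0] subspace_0[OF subspace_H] in simp)
  from *[of 0] show ?thesis by simp
qed

text \<open>On the domain \<open>J h y - y\<close> is of order \<open>h\<close>; density and the
  bound on \<open>J h\<close> do the rest. It provides approximants of higher regularity.\<close>

lemma J_near_self:
  assumes x: "x \<in> H" and "e > 0"
  shows "\<exists>h>0. norm (J h x - x) < e"
proof -
  have e: "e / (2 * (M + 1)) > 0" using \<open>e > 0\<close> M_ge_1 by simp
  from dense[OF x e] obtain y where y: "y \<in> D" "norm (x - y) < e / (2 * (M + 1))" by blast
  \<comment> \<open>The summand 1 avoids a vanishing denominator when
    \<open>A y = 0\<close>.\<close>
  define h where "h = e / (2 * (M * norm (A y) + 1))"
  have C: "M * norm (A y) \<ge> 0" using M_ge_1 by simp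
  have h: "h > 0" unfolding h_def using \<open>e > 0\<close> C by simp
  have yH: "y \<in> H" using y D_in_H by auto
  have "J h x - x = J h (x - y) + (J h y - y) + (y - x)"
    using h x yH by (simp add: J_diff)
  then have "norm (J h x - x) \<le> norm (J h (x - y)) + norm (J h y - y) + norm (x - y)"
    by (metis norm_minus_commute norm_triangle_le norm_triangle_ineq add_mono order_refl)
  also have "\<dots> \<le> M * norm (x - y) + h * (M * norm (A y)) + norm (x - y)"
    using J_bound[of h "x - y"] norm_pow_minus_self[of h y 1] h x y yH by (simp add: H_intros)
  also have "\<dots> = (M + 1) * norm (x - y) + h * (M * norm (A y))"
    by (simp add: algebra_simps)
  also have "\<dots> < e / 2 + e / 2"
  proof (rule add_less_le_mono)
    show "(M + 1) * norm (x - y) < e / 2"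
      using y(2) M_ge_1 by (simp add: field_simps)
    show "h * (M * norm (A y)) \<le> e / 2"
      unfolding h_def using C \<open>e > 0\<close> by (simp add: divide_simps add_nonneg_eq_0_iff)
  qed
  finally show ?thesis using h by auto
qed

text \<open>\<open>J h\<close> maps the domain of \<open>A\<close> into the domain of
  \<open>A^2\<close>, because it commutes with \<open>A\<close>.\<close>

lemma dense_D2:
  assumes x: "x \<in> H" and "e > 0"
  shows "\<exists>y\<in>D. A y \<in> D \<and> norm (x - y) < e"
proof -
  obtain z where z: "z \<in> D" "norm (x - z) < e / 2" using dense[OF x, of "e/2"] \<open>e > 0\<close> by auto
  obtain h where h: "h > 0" "norm (J h z - z) < e / 2"
    using J_near_self[of z "e/2"] z D_in_H \<open>e > 0\<close> by auto
  have "norm (x - J h z) < e"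
    using norm_triangle_ineq[of "x - z" "z - J h z"] h z by (simp add: norm_minus_commute)
  moreover have "J h z \<in> D" "A (J h z) \<in> D"
    using h z by (auto simp: J_A intro: J_in_D A_in D_in_H)
  ultimately show ?thesis by blast
qed

section \<open>Convergence of the scheme and the semigroup law\<close>

definition euler :: "nat \<Rightarrow> real \<Rightarrow> 'h \<Rightarrow> 'h" where
  "euler k t = J ((1/2) ^ k) ^^ dyadic_steps k t"

definition semigroup :: "real \<Rightarrow> 'h \<Rightarrow> 'h" where
  "semigroup t x = lim (\<lambda>k. euler k t x)"

lemma euler_in: "x \<in> H \<Longrightarrow> euler k t x \<in> H"
  unfolding euler_def by (intro pow_in) auto

lemma euler_bound: "x \<in> H \<Longrightarrow> norm (euler k t x) \<le> M * norm x"
  unfolding euler_def by (intro J_power_bound) auto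

lemma euler_diff: "x \<in> H \<Longrightarrow> y \<in> H \<Longrightarrow> euler k t (x - y) = euler k t x - euler k t y"
  unfolding euler_def by (intro pow_diff) auto

lemma Cauchy_euler_D2:
  assumes t: "t \<ge> 0" and x: "x \<in> D" "A x \<in> D"
  shows "Cauchy (\<lambda>k. euler k t x)"
proof (rule Cauchy_of_geometric_steps)
  fix k
  let ?C = "M * (M * norm (A (A x)))" and ?B = "M * norm (A x)"
  define h :: real where "h = (1/2) ^ Suc k"
  define n where "n = dyadic_steps k t"
  have C: "?C \<ge> 0" and B: "?B \<ge> 0" using M_ge_1 by simp_all
  have h: "h > 0" "2 * h = (1/2) ^ k" "h \<le> 1" unfolding h_def by (simp_all add: power_le_one del: power_Suc) simp
  \<comment> \<open>The two approximants are compared through \<open>2 * n\<close> steps of length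
    \<open>h\<close>, from which the finer one differs by at most one step.\<close>
  have "norm ((J h ^^ dyadic_steps (Suc k) t) x - (J h ^^ (2 * n)) x) \<le> h * ?B"
    using dyadic_steps_Suc[OF t, of k] norm_pow_Suc_diff[OF h(1) x(1), of "2 * n"] h(1) B
    unfolding n_def insert_iff empty_iff by (elim disjE) (simp_all del: funpow.simps(2))
  moreover have "norm ((J (2 * h) ^^ n) x - (J h ^^ (2 * n)) x) \<le> real n * (h\<^sup>2 * ?C)"
    by (rule norm_pow_double_step[OF h(1) x])
  \<comment> \<open>The \<open>n\<close> local errors of size \<open>h^2\<close> add up to order
    \<open>h\<close>, since the elapsed time \<open>n * (2 * h)\<close> does not exceed
    \<open>t\<close>.\<close>
  moreover have "real n * (h\<^sup>2 * ?C) \<le> t * (h * ?C)"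
  proof -
    have "real n * h \<le> t"
      using dyadic_steps_bounds(1)[OF t, of k] mult_nonneg_nonneg[of "real n" h] h(1)
      unfolding n_def h(2)[symmetric] mult.left_commute[of _ "2::real"] by linarith
    then have "(real n * h) * (h * ?C) \<le> t * (h * ?C)"
      using h C by (intro mult_right_mono) auto
    then show ?thesis by (simp add: power2_eq_square mult.assoc)
  qed
  ultimately have "norm ((J h ^^ dyadic_steps (Suc k) t) x - (J (2 * h) ^^ n) x) \<le> h * ?B + t * (h * ?C)"
    using norm_triangle_ineq4[of "(J h ^^ dyadic_steps (Suc k) t) x - (J h ^^ (2 * n)) x"
        "(J (2 * h) ^^ n) x - (J h ^^ (2 * n)) x"] by simp
  also have "\<dots> = (?B + t * ?C) / 2 * (1/2) ^ k"
    unfolding h_def by (simp add: algebra_simps)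
  finally show "norm (euler (Suc k) t x - euler k t x) \<le> (?B + t * ?C) / 2 * (1/2) ^ k"
    unfolding euler_def h(2) h_def[symmetric] n_def by simp
qed auto

lemma Cauchy_euler:
  assumes t: "t \<ge> 0" and x: "x \<in> H"
  shows "Cauchy (\<lambda>k. euler k t x)"
proof (rule metric_CauchyI)
  fix e :: real assume e: "e > 0"
  have "e / (3 * M) > 0" using e M_ge_1 by simp
  from dense_D2[OF x this] obtain y where y: "y \<in> D" "A y \<in> D" "norm (x - y) < e / (3 * M)" by blast
  have yH: "y \<in> H" using y D_in_H by auto
  from metric_CauchyD[OF Cauchy_euler_D2[OF t y(1,2)], of "e/3"] e obtain N
    where N: "\<And>k l. k \<ge> N \<Longrightarrow> l \<ge> N \<Longrightarrow> dist (euler k t y) (euler l t y) < e / 3" by auto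
  have near: "dist (euler k t x) (euler k t y) < e / 3" for k
  proof -
    have "norm (euler k t (x - y)) \<le> M * norm (x - y)"
      using x yH by (intro euler_bound H_intros)
    also have "\<dots> < e / 3"
      using y(3) M_ge_1 by (simp add: field_simps)
    finally show ?thesis using x yH by (simp add: euler_diff dist_norm)
  qed
  show "\<exists>N. \<forall>k\<ge>N. \<forall>l\<ge>N. dist (euler k t x) (euler l t x) < e"
  proof (intro exI allI impI)
    fix k l assume "N \<le> k" "N \<le> l"
    then show "dist (euler k t x) (euler l t x) < e"
      using N[of k l] near[of k] near[of l]
        dist_triangle[of "euler k t x" "euler l t x" "euler k t y"]
        dist_triangle[of "euler k t y" "euler l t x" "euler l t y"]
      by (simp add: dist_commute)
  qed
qed

lemma euler_tendsto:
  assumes "t \<ge> 0" "x \<in> H"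
  shows "(\<lambda>k. euler k t x) \<longlonglongrightarrow> semigroup t x" "semigroup t x \<in> H"
proof -
  obtain l where l: "l \<in> H" "(\<lambda>k. euler k t x) \<longlonglongrightarrow> l"
    using completeE[OF complete_H, of "\<lambda>k. euler k t x"] Cauchy_euler[OF assms] euler_in[OF assms(2)] by auto
  then show "(\<lambda>k. euler k t x) \<longlonglongrightarrow> semigroup t x" "semigroup t x \<in> H"
    unfolding semigroup_def using limI by metis+
qed

lemma semigroup_bound:
  assumes "t \<ge> 0" "x \<in> H"
  shows "norm (semigroup t x) \<le> M * norm x"
  by (rule Lim_bounded[OF tendsto_norm[OF euler_tendsto(1)[OF assms]], of 0])
    (use euler_bound assms in auto)

lemma semigroup_add:
  assumes "t \<ge> 0" "x \<in> H" "y \<in> H"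
  shows "semigroup t (x + y) = semigroup t x + semigroup t y"
proof (rule LIMSEQ_unique)
  show "(\<lambda>k. euler k t (x + y)) \<longlonglongrightarrow> semigroup t (x + y)"
    using assms by (intro euler_tendsto H_intros)
  have "euler k t (x + y) = euler k t x + euler k t y" for k
    unfolding euler_def using assms by (intro pow_add) auto
  then show "(\<lambda>k. euler k t (x + y)) \<longlonglongrightarrow> semigroup t x + semigroup t y"
    using assms by (simp add: tendsto_add euler_tendsto)
qed

lemma semigroup_scaleR:
  assumes "t \<ge> 0" "x \<in> H"
  shows "semigroup t (c *\<^sub>R x) = c *\<^sub>R semigroup t x"
proof (rule LIMSEQ_unique)
  show "(\<lambda>k. euler k t (c *\<^sub>R x)) \<longlonglongrightarrow> semigroup t (c *\<^sub>R x)"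
    using assms by (intro euler_tendsto H_intros)
  have "euler k t (c *\<^sub>R x) = c *\<^sub>R euler k t x" for k
    unfolding euler_def using assms by (intro pow_scaleR) auto
  then show "(\<lambda>k. euler k t (c *\<^sub>R x)) \<longlonglongrightarrow> c *\<^sub>R semigroup t x"
    using assms by (auto intro!: tendsto_intros euler_tendsto)
qed

lemma semigroup_diff:
  assumes "t \<ge> 0" "x \<in> H" "y \<in> H"
  shows "semigroup t (x - y) = semigroup t x - semigroup t y"
  using semigroup_add[of t x "- 1 *\<^sub>R y"] semigroup_scaleR[of t y "- 1"] H_intros(3)[of y "- 1"] assms
  by simp

lemma semigroup_zero: "x \<in> H \<Longrightarrow> semigroup 0 x = x"
  by (simp add: semigroup_def euler_def dyadic_steps_def)

text \<open>Resolvents of different steps commute, and \<open>J h\<close> is bounded, so commutation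
  passes to the limit. This later identifies the domain of the generator.\<close>

lemma semigroup_J:
  assumes "t \<ge> 0" "x \<in> H" "h > 0"
  shows "J h (semigroup t x) = semigroup t (J h x)"
proof (rule LIMSEQ_unique)
  have in_H: "semigroup t x \<in> H" using euler_tendsto assms by auto
  have "(\<lambda>k. M * norm (euler k t x - semigroup t x)) \<longlonglongrightarrow> 0"
    using euler_tendsto(1)[OF assms(1,2)]
    by (intro tendsto_mult_right_zero tendsto_norm_zero) (simp add: LIM_zero)
  then have "(\<lambda>k. J h (euler k t x) - J h (semigroup t x)) \<longlonglongrightarrow> 0"
  proof (rule Lim_null_comparison[rotated])
    show "\<forall>\<^sub>F k in sequentially. norm (J h (euler k t x) - J h (semigroup t x))
        \<le> M * norm (euler k t x - semigroup t x)"
      using assms in_H euler_in J_bound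
      by (simp add: J_diff[symmetric] H_intros)
  qed
  then show "(\<lambda>k. J h (euler k t x)) \<longlonglongrightarrow> J h (semigroup t x)"
    by (rule LIM_zero_cancel)
  have "J h (euler k t x) = euler k t (J h x)" for k
    unfolding euler_def using assms by (intro pow_J) auto
  then show "(\<lambda>k. J h (euler k t x)) \<longlonglongrightarrow> semigroup t (J h x)"
    using assms by (simp add: euler_tendsto J_in)
qed

text \<open>The approximants obey the law up to one surplus step, whose effect vanishes in the limit
  when \<open>x\<close> lies in the domain.\<close>

lemma semigroup_law_D:
  assumes "t \<ge> 0" "s \<ge> 0" "x \<in> D"
  shows "semigroup (t + s) x = semigroup t (semigroup s x)"
proof (rule LIMSEQ_unique)
  have x: "x \<in> H" using assms D_in_H by auto
  have Ss: "semigroup s x \<in> H" using euler_tendsto assms x by auto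
  \<comment> \<open>Operator and argument both vary with \<open>k\<close>; the bound
    \<open>M\<close> is uniform in \<open>k\<close>, so the argument may be replaced by its
    limit.\<close>
  have "(\<lambda>k. euler k t (euler k s x) - euler k t (semigroup s x)) \<longlonglongrightarrow> 0"
  proof (rule Lim_null_comparison)
    show "(\<lambda>k. M * norm (euler k s x - semigroup s x)) \<longlonglongrightarrow> 0"
      using euler_tendsto(1)[OF assms(2) x]
      by (intro tendsto_mult_right_zero tendsto_norm_zero) (simp add: LIM_zero)
    show "\<forall>\<^sub>F k in sequentially. norm (euler k t (euler k s x) - euler k t (semigroup s x))
        \<le> M * norm (euler k s x - semigroup s x)"
      using x Ss by (simp add: euler_diff[symmetric] euler_in euler_bound H_intros)
  qed
  from tendsto_add[OF this euler_tendsto(1)[OF assms(1) Ss]]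
  have 1: "(\<lambda>k. euler k t (euler k s x)) \<longlonglongrightarrow> semigroup t (semigroup s x)" by simp
  have "(\<lambda>k. euler k (t + s) x - euler k t (euler k s x)) \<longlonglongrightarrow> 0"
  proof (rule Lim_null_comparison)
    show "(\<lambda>k. (1/2) ^ k * (M * norm (A x))) \<longlonglongrightarrow> 0"
      by (intro tendsto_mult_left_zero LIMSEQ_realpow_zero) auto
    have "norm (euler k (t + s) x - euler k t (euler k s x)) \<le> (1/2) ^ k * (M * norm (A x))" for k
    proof -
      let ?n = "dyadic_steps k t + dyadic_steps k s" and ?h = "(1/2::real) ^ k"
      have "euler k t (euler k s x) = (J ?h ^^ ?n) x"
        unfolding euler_def by (simp add: funpow_add)
      moreover have "norm ((J ?h ^^ Suc ?n) x - (J ?h ^^ ?n) x) \<le> ?h * (M * norm (A x))"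
        by (rule norm_pow_Suc_diff) (use assms in auto)
      ultimately show ?thesis
        using dyadic_steps_add[OF assms(1,2), of k] M_ge_1 unfolding euler_def[of k "t + s"] by auto
    qed
    then show "\<forall>\<^sub>F k in sequentially. norm (euler k (t + s) x - euler k t (euler k s x))
        \<le> (1/2) ^ k * (M * norm (A x))" by simp
  qed
  from tendsto_add[OF this 1] show "(\<lambda>k. euler k (t + s) x) \<longlonglongrightarrow> semigroup t (semigroup s x)" by simp
  show "(\<lambda>k. euler k (t + s) x) \<longlonglongrightarrow> semigroup (t + s) x"
    using assms x by (intro euler_tendsto) auto
qed

text \<open>The defect of the law is a bounded linear map that vanishes on the dense domain.\<close>

lemma semigroup_law:
  assumes "t \<ge> 0" "s \<ge> 0" and x: "x \<in> H"
  shows "semigroup (t + s) x = semigroup t (semigroup s x)"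
proof -
  define E where "E y = semigroup (t + s) y - semigroup t (semigroup s y)" for y
  have in_H: "r \<ge> 0 \<Longrightarrow> y \<in> H \<Longrightarrow> semigroup r y \<in> H" for r y using euler_tendsto by auto
  have E_bound: "norm (E y) \<le> (M + M * M) * norm y" if y: "y \<in> H" for y
  proof -
    have "norm (semigroup t (semigroup s y)) \<le> M * (M * norm y)"
      using semigroup_bound[OF assms(1) in_H[OF assms(2) y]] semigroup_bound[OF assms(2) y] M_ge_1
        mult_left_mono[of "norm (semigroup s y)" "M * norm y" M] by linarith
    moreover have "norm (semigroup (t + s) y) \<le> M * norm y"
      using assms y by (intro semigroup_bound) auto
    ultimately show ?thesis
      unfolding E_def using norm_triangle_ineq4[of "semigroup (t + s) y" "semigroup t (semigroup s y)"]
      by (simp add: algebra_simps)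
  qed
  have "norm (E x) \<le> 0"
  proof (rule field_le_epsilon)
    fix e :: real assume "e > 0"
    have K: "M + M * M > 0" using M_ge_1 by (simp add: add_pos_pos)
    have "e / (M + M * M) > 0" using K \<open>e > 0\<close> by simp
    from dense[OF x this] obtain y where y: "y \<in> D" "norm (x - y) < e / (M + M * M)" by blast
    have yH: "y \<in> H" using y D_in_H by auto
    have "E x = E (x - y)"
      using semigroup_law_D[OF assms(1,2) y(1)] assms x yH unfolding E_def
      by (simp add: semigroup_diff in_H)
    also have "norm \<dots> \<le> (M + M * M) * norm (x - y)"
      using x yH by (intro E_bound H_intros)
    also have "\<dots> \<le> e" using y(2) K by (simp add: field_simps)
    finally show "norm (E x) \<le> 0 + e" by simp
  qed
  then show ?thesis by (simp add: E_def)
qed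

section \<open>Behaviour at time zero and the generator\<close>

lemma norm_semigroup_minus_self:
  assumes "t \<ge> 0" "x \<in> D"
  shows "norm (semigroup t x - x) \<le> t * (M * norm (A x))"
proof (rule Lim_bounded)
  show "(\<lambda>k. norm (euler k t x - x)) \<longlonglongrightarrow> norm (semigroup t x - x)"
    using assms D_in_H by (intro tendsto_intros euler_tendsto) auto
  show "\<forall>k\<ge>0. norm (euler k t x - x) \<le> t * (M * norm (A x))"
  proof (intro allI impI)
    fix k
    have "norm (euler k t x - x) \<le> real (dyadic_steps k t) * (1/2) ^ k * (M * norm (A x))"
      unfolding euler_def using assms by (intro norm_pow_minus_self) auto
    also have "\<dots> \<le> t * (M * norm (A x))"
      using dyadic_steps_bounds(1)[OF assms(1), of k] M_ge_1 by (intro mult_right_mono) auto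
    finally show "norm (euler k t x - x) \<le> t * (M * norm (A x))" .
  qed
qed

lemma norm_semigroup_second_order:
  assumes t: "t \<ge> 0" and x: "x \<in> D" "A x \<in> D"
  shows "norm (semigroup t x - x - t *\<^sub>R A x) \<le> t\<^sup>2 * (M * norm (A (A x)))"
proof (rule Lim_bounded)
  show "(\<lambda>k. norm (euler k t x - x - (real (dyadic_steps k t) * (1/2) ^ k) *\<^sub>R A x))
      \<longlonglongrightarrow> norm (semigroup t x - x - t *\<^sub>R A x)"
    using assms D_in_H by (intro tendsto_intros euler_tendsto dyadic_steps_tendsto) auto
  show "\<forall>k\<ge>0. norm (euler k t x - x - (real (dyadic_steps k t) * (1/2) ^ k) *\<^sub>R A x)
      \<le> t\<^sup>2 * (M * norm (A (A x)))"
  proof (intro allI impI)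
    fix k
    have "norm (euler k t x - x - (real (dyadic_steps k t) * (1/2) ^ k) *\<^sub>R A x)
        \<le> (real (dyadic_steps k t) * (1/2) ^ k)\<^sup>2 * (M * norm (A (A x)))"
      unfolding euler_def using assms by (intro norm_pow_second_order) auto
    also have "\<dots> \<le> t\<^sup>2 * (M * norm (A (A x)))"
      using dyadic_steps_bounds(1)[OF t, of k] M_ge_1 by (intro mult_right_mono power_mono) auto
    finally show "norm (euler k t x - x - (real (dyadic_steps k t) * (1/2) ^ k) *\<^sub>R A x)
        \<le> t\<^sup>2 * (M * norm (A (A x)))" .
  qed
qed

lemma semigroup_continuous:
  assumes x: "x \<in> H"
  shows "((\<lambda>t. semigroup t x) \<longlongrightarrow> x) (at_right 0)"
proof (rule tendstoI)
  fix e :: real assume e: "e > 0"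
  have "e / (2 * (M + 1)) > 0" using e M_ge_1 by simp
  from dense[OF x this] obtain y where y: "y \<in> D" "norm (x - y) < e / (2 * (M + 1))" by blast
  have yH: "y \<in> H" using y D_in_H by auto
  have "((\<lambda>t. t * (M * norm (A y))) \<longlongrightarrow> 0 * (M * norm (A y))) (at_right 0)"
    by (intro tendsto_intros)
  then have "\<forall>\<^sub>F t in at_right 0. t * (M * norm (A y)) < e / 2"
    by (rule order_tendstoD) (use e in auto)
  moreover have "\<forall>\<^sub>F t::real in at_right 0. t > 0"
    by (simp add: eventually_at_filter)
  ultimately show "\<forall>\<^sub>F t in at_right 0. dist (semigroup t x) x < e"
  proof eventually_elim
    case (elim t)
    have "semigroup t x - x = semigroup t (x - y) + (semigroup t y - y) + (y - x)"
      using elim x yH by (simp add: semigroup_diff)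
    then have "norm (semigroup t x - x) \<le> norm (semigroup t (x - y)) + norm (semigroup t y - y) + norm (x - y)"
      by (metis norm_minus_commute norm_triangle_le norm_triangle_ineq add_mono order_refl)
    also have "\<dots> \<le> M * norm (x - y) + t * (M * norm (A y)) + norm (x - y)"
      using elim x y yH by (intro add_mono semigroup_bound norm_semigroup_minus_self H_intros) auto
    also have "\<dots> = (M + 1) * norm (x - y) + t * (M * norm (A y))"
      by (simp add: algebra_simps)
    also have "\<dots> < e / 2 + e / 2"
    proof (rule add_strict_mono)
      show "(M + 1) * norm (x - y) < e / 2"
        using y(2) M_ge_1 by (simp add: field_simps)
    qed (use elim in auto)
    finally show ?case by (simp add: dist_norm)
  qed
qed

text \<open>The second-order estimate differentiates only on the domain of \<open>A^2\<close>. The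
  approximant \<open>y = J h x\<close> lies there with \<open>A y\<close> near \<open>A x\<close>,
  and the first-order estimate bounds the quotient of \<open>x - y\<close> by
  \<open>M * norm (A (x - y))\<close>, uniformly in \<open>t\<close>.\<close>

lemma semigroup_derivative:
  assumes x: "x \<in> D"
  shows "((\<lambda>t. (1 / t) *\<^sub>R (semigroup t x - x)) \<longlongrightarrow> A x) (at_right 0)"
proof (rule tendstoI)
  fix e :: real assume e: "e > 0"
  have "e / (2 * (M + 1)) > 0" using e M_ge_1 by simp
  from J_near_self[OF A_in[OF x] this] obtain h
    where h: "h > 0" "norm (J h (A x) - A x) < e / (2 * (M + 1))" by blast
  define y where "y = J h x"
  have xH: "x \<in> H" using x D_in_H by auto
  have y: "y \<in> D" "A y = J h (A x)" "A y \<in> D" "y \<in> H"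
    unfolding y_def using h x xH by (simp_all add: J_A J_in_D A_in J_in)
  have "((\<lambda>t. t * (M * norm (A (A y)))) \<longlongrightarrow> 0 * (M * norm (A (A y)))) (at_right 0)"
    by (intro tendsto_intros)
  then have "\<forall>\<^sub>F t in at_right 0. t * (M * norm (A (A y))) < e / 2"
    by (rule order_tendstoD) (use e in auto)
  moreover have "\<forall>\<^sub>F t::real in at_right 0. t > 0"
    by (simp add: eventually_at_filter)
  ultimately show "\<forall>\<^sub>F t in at_right 0. dist ((1 / t) *\<^sub>R (semigroup t x - x)) (A x) < e"
  proof eventually_elim
    case (elim t)
    have "(1 / t) *\<^sub>R (semigroup t x - x) - A x = (1 / t) *\<^sub>R (semigroup t (x - y) - (x - y))
        + (1 / t) *\<^sub>R (semigroup t y - y - t *\<^sub>R A y) + (A y - A x)"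
      using elim xH y by (simp add: semigroup_diff algebra_simps)
    then have "norm ((1 / t) *\<^sub>R (semigroup t x - x) - A x) \<le>
        norm ((1 / t) *\<^sub>R (semigroup t (x - y) - (x - y)))
        + norm ((1 / t) *\<^sub>R (semigroup t y - y - t *\<^sub>R A y)) + norm (A y - A x)"
      by (metis norm_triangle_le norm_triangle_ineq add_mono order_refl)
    also have "\<dots> \<le> M * norm (A y - A x) + t * (M * norm (A (A y))) + norm (A y - A x)"
    proof (intro add_mono order_refl)
      have "norm (semigroup t (x - y) - (x - y)) \<le> t * (M * norm (A (x - y)))"
        using elim x y by (intro norm_semigroup_minus_self D_intros) auto
      then have "norm (semigroup t (x - y) - (x - y)) / t \<le> M * norm (A x - A y)"
        using elim x y by (simp add: A_diff pos_divide_le_eq mult.commute)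
      then show "norm ((1 / t) *\<^sub>R (semigroup t (x - y) - (x - y))) \<le> M * norm (A y - A x)"
        using elim by (simp add: norm_minus_commute[of "A y"])
      have "norm (semigroup t y - y - t *\<^sub>R A y) \<le> t\<^sup>2 * (M * norm (A (A y)))"
        using elim y by (intro norm_semigroup_second_order) auto
      then have "norm (semigroup t y - y - t *\<^sub>R A y) / t \<le> t * (M * norm (A (A y)))"
        using elim by (simp add: pos_divide_le_eq power2_eq_square ac_simps)
      then show "norm ((1 / t) *\<^sub>R (semigroup t y - y - t *\<^sub>R A y)) \<le> t * (M * norm (A (A y)))"
        using elim by simp
    qed
    also have "\<dots> = (M + 1) * norm (A y - A x) + t * (M * norm (A (A y)))"
      by (simp add: algebra_simps)
    also have "\<dots> < e / 2 + e / 2"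
    proof (rule add_strict_mono)
      show "(M + 1) * norm (A y - A x) < e / 2"
        using h(2) M_ge_1 unfolding y(2) by (simp add: field_simps)
    qed (use elim in auto)
    finally show ?case by (simp add: dist_norm)
  qed
qed

text \<open>If \<open>y\<close> is the derivative at \<open>x\<close>, then differentiating \<open>J 1 (semigroup t x) = semigroup t (J 1 x)\<close>
  gives \<open>J 1 y = A (J 1 x) = J 1 x - x\<close>.\<close>

lemma semigroup_derivative_imp_in_D:
  assumes x: "x \<in> H" and y: "y \<in> H"
    and lim: "((\<lambda>t. (1 / t) *\<^sub>R (semigroup t x - x)) \<longlongrightarrow> y) (at_right 0)"
  shows "x \<in> D"
proof -
  have "((\<lambda>t. (1 / t) *\<^sub>R (semigroup t (J 1 x) - J 1 x) - J 1 y) \<longlongrightarrow> 0) (at_right 0)"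
  proof (rule Lim_null_comparison)
    show "((\<lambda>t. M * norm ((1 / t) *\<^sub>R (semigroup t x - x) - y)) \<longlongrightarrow> 0) (at_right 0)"
      using lim by (intro tendsto_mult_right_zero tendsto_norm_zero) (simp add: LIM_zero)
    have "\<forall>\<^sub>F t::real in at_right 0. t > 0"
      by (simp add: eventually_at_filter)
    then show "\<forall>\<^sub>F t in at_right 0. norm ((1 / t) *\<^sub>R (semigroup t (J 1 x) - J 1 x) - J 1 y)
        \<le> M * norm ((1 / t) *\<^sub>R (semigroup t x - x) - y)"
    proof eventually_elim
      case (elim t)
      have Sx: "semigroup t x \<in> H" using euler_tendsto elim x by auto
      have "(1 / t) *\<^sub>R (semigroup t (J 1 x) - J 1 x) - J 1 y = J 1 ((1 / t) *\<^sub>R (semigroup t x - x) - y)"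
        using elim x y Sx
        by (simp add: J_diff J_scaleR H_intros semigroup_J)
      then show ?case
        using x y Sx by (auto intro!: J_bound H_intros)
    qed
  qed
  then have "((\<lambda>t. (1 / t) *\<^sub>R (semigroup t (J 1 x) - J 1 x)) \<longlongrightarrow> J 1 y) (at_right 0)"
    by (rule LIM_zero_cancel)
  moreover have "((\<lambda>t. (1 / t) *\<^sub>R (semigroup t (J 1 x) - J 1 x)) \<longlongrightarrow> A (J 1 x)) (at_right 0)"
    using x by (intro semigroup_derivative J_in_D) auto
  ultimately have "J 1 y = A (J 1 x)"
    by (intro tendsto_unique[of "at_right (0::real)"]) auto
  \<comment> \<open>Inserting \<open>J 1 y\<close> for \<open>A (J 1 x)\<close> in
    \<open>J_right\<close> exhibits \<open>x\<close> in the range of \<open>J 1\<close>, which is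
    contained in \<open>D\<close>.\<close>
  then have "x = J 1 (x - y)"
    using J_right[of 1 x] x y by (simp add: J_diff algebra_simps)
  then show ?thesis using J_in_D[of 1 "x - y"] x y by (simp add: H_intros)
qed

lemma C0_semigroup_on_semigroup: "C0_semigroup_on H semigroup"
  unfolding C0_semigroup_on_def bounded_linear_op_on_def
  using euler_tendsto(2) semigroup_add semigroup_scaleR semigroup_bound
    semigroup_zero semigroup_law semigroup_continuous
  by (auto intro!: exI[of _ M])

lemma generator_semigroup: "infinitesimal_generator_on H semigroup D A"
  unfolding infinitesimal_generator_on_def
  using semigroup_derivative semigroup_derivative_imp_in_D A_in D_in_H by blast

end

section \<open>Dissipative pairs\<close>

lemma norm_le_opnorm_on:
  assumes T: "bounded_linear_op_on H T" and x: "x \<in> H"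
  shows "norm (T x) \<le> opnorm_on H T * norm x"
proof -
  obtain C where C: "C > 0" "\<forall>x\<in>H. norm (T x) \<le> C * norm x"
    using bounded_linear_op_on_bound[OF T] by blast
  have "bdd_above ((\<lambda>x. norm (T x) / norm x) ` H)"
  proof (rule bdd_aboveI2)
    fix y assume "y \<in> H"
    with C show "norm (T y) / norm y \<le> C" by (cases "y = 0") (auto simp: divide_le_eq)
  qed
  then have "norm (T x) / norm x \<le> opnorm_on H T"
    unfolding opnorm_on_def using x by (intro cSUP_upper)
  moreover have "x = 0 \<Longrightarrow> norm (T x) = 0"
    using C x by force
  ultimately show ?thesis by (cases "x = 0") (auto simp: divide_le_eq)
qed

lemma opnorm_on_le:
  assumes "H \<noteq> {}" "C \<ge> 0" "\<And>x. x \<in> H \<Longrightarrow> norm (T x) \<le> C * norm x"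
  shows "opnorm_on H T \<le> C"
  unfolding opnorm_on_def
proof (rule cSUP_least[OF assms(1)])
  fix x assume "x \<in> H"
  with assms show "norm (T x) / norm x \<le> C" by (cases "x = 0") (auto simp: divide_le_eq)
qed

lemma subspace_closure:
  fixes S :: "'a::real_normed_vector set"
  assumes "subspace S"
  shows "subspace (closure S)"
  unfolding subspace_def
proof (intro conjI ballI allI)
  show "0 \<in> closure S"
    using subspace_0[OF assms] closure_subset by blast
  fix x assume "x \<in> closure S"
  then obtain f where f: "\<And>n. f n \<in> S" "f \<longlonglongrightarrow> x"
    unfolding closure_sequential by blast
  show "x + y \<in> closure S" if y: "y \<in> closure S" for y
  proof -
    obtain g where g: "\<And>n. g n \<in> S" "g \<longlonglongrightarrow> y"
      using y unfolding closure_sequential by blast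
    show ?thesis
      unfolding closure_sequential
      using f g by (intro exI[of _ "\<lambda>n. f n + g n"]) (auto intro: tendsto_add subspace_add[OF assms])
  qed
  show "c *\<^sub>R x \<in> closure S" for c
    unfolding closure_sequential
    using f by (intro exI[of _ "\<lambda>n. c *\<^sub>R f n"]) (auto intro: tendsto_scaleR subspace_scale[OF assms])
qed

text \<open>The product rule at 0, with the increment split so that the exponential multiplies the
  quotient of \<open>g\<close>. Allowing any sign of \<open>\<omega>\<close> lets it also undo a
  rescaling.\<close>

lemma difference_quotient_exp_scaleR:
  fixes g :: "real \<Rightarrow> 'h::real_normed_vector"
  assumes "((\<lambda>t. (1 / t) *\<^sub>R (g t - x)) \<longlongrightarrow> y) (at_right 0)"
  shows "((\<lambda>t. (1 / t) *\<^sub>R (exp (\<omega> * t) *\<^sub>R g t - x)) \<longlongrightarrow> y + \<omega> *\<^sub>R x) (at_right 0)"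
proof -
  have "((\<lambda>t. exp (\<omega> * t)) has_field_derivative \<omega>) (at 0)"
    by (auto intro!: derivative_eq_intros)
  then have "((\<lambda>t. (exp (\<omega> * t) - 1) / t) \<longlongrightarrow> \<omega>) (at 0)"
    by (simp add: has_field_derivative_iff)
  then have q: "((\<lambda>t. (exp (\<omega> * t) - 1) / t) \<longlongrightarrow> \<omega>) (at_right 0)"
    by (rule filterlim_mono) (auto simp: at_le)
  have "((\<lambda>t. exp (\<omega> * t)) \<longlongrightarrow> exp (\<omega> * 0)) (at_right 0)"
    by (intro tendsto_intros)
  then have "((\<lambda>t. exp (\<omega> * t) *\<^sub>R ((1 / t) *\<^sub>R (g t - x)) + ((exp (\<omega> * t) - 1) / t) *\<^sub>R x)
      \<longlongrightarrow> exp (\<omega> * 0) *\<^sub>R y + \<omega> *\<^sub>R x) (at_right 0)"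
    by (intro tendsto_add tendsto_scaleR assms q tendsto_const)
  moreover have "exp (\<omega> * t) *\<^sub>R ((1 / t) *\<^sub>R (g t - x)) + ((exp (\<omega> * t) - 1) / t) *\<^sub>R x
      = (1 / t) *\<^sub>R (exp (\<omega> * t) *\<^sub>R g t - x)" for t
    by (simp add: algebra_simps diff_divide_distrib)
  ultimately show ?thesis by simp
qed

lemma C0_semigroup_on_rescale:
  assumes S: "C0_semigroup_on H S" and H: "subspace H"
  shows "C0_semigroup_on H (\<lambda>t x. exp (\<omega> * t) *\<^sub>R S t x)"
proof -
  have op: "bounded_linear_op_on H (S t)" if "t \<ge> 0" for t
    using S that by (simp add: C0_semigroup_on_def)
  have "bounded_linear_op_on H (\<lambda>x. exp (\<omega> * t) *\<^sub>R S t x)" if "t \<ge> 0" for t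
    using bounded_linear_op_on_combine[OF H op[OF that] op[OF that], of "exp (\<omega> * t)" 0] by simp
  moreover have "exp (\<omega> * (t + s)) *\<^sub>R S (t + s) x = exp (\<omega> * t) *\<^sub>R S t (exp (\<omega> * s) *\<^sub>R S s x)"
    if "t \<ge> 0" "s \<ge> 0" "x \<in> H" for t s x
    using S that bounded_linear_op_onD(1)[OF op[OF that(2)] that(3)] bounded_linear_op_onD(3)[OF op[OF that(1)]]
    by (simp add: C0_semigroup_on_def exp_add distrib_left)
  moreover have "((\<lambda>t. exp (\<omega> * t) *\<^sub>R S t x) \<longlongrightarrow> x) (at_right 0)" if "x \<in> H" for x
  proof -
    have "((\<lambda>t. exp (\<omega> * t) *\<^sub>R S t x) \<longlongrightarrow> exp (\<omega> * 0) *\<^sub>R x) (at_right 0)"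
      using S that by (intro tendsto_intros) (simp add: C0_semigroup_on_def)
    then show ?thesis by simp
  qed
  ultimately show ?thesis
    using S by (simp add: C0_semigroup_on_def)
qed

lemma infinitesimal_generator_on_rescale:
  assumes gen: "infinitesimal_generator_on H S D A" and H: "subspace H"
    and A': "\<And>x. x \<in> D \<Longrightarrow> A' x = A x + \<omega> *\<^sub>R x"
  shows "infinitesimal_generator_on H (\<lambda>t x. exp (\<omega> * t) *\<^sub>R S t x) D A'"
proof -
  have "x \<in> D" if x: "x \<in> H" and y: "y \<in> H"
    and lim: "((\<lambda>t. (1 / t) *\<^sub>R (exp (\<omega> * t) *\<^sub>R S t x - x)) \<longlongrightarrow> y) (at_right 0)" for x y
  proof -
    \<comment> \<open>Rescaling by \<open>- \<omega>\<close> recovers the original quotient, so the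
      domain does not grow.\<close>
    have "((\<lambda>t. (1 / t) *\<^sub>R (S t x - x)) \<longlongrightarrow> y + (- \<omega>) *\<^sub>R x) (at_right 0)"
      using difference_quotient_exp_scaleR[OF lim, of "- \<omega>"] by (simp add: exp_minus)
    moreover have "y + (- \<omega>) *\<^sub>R x \<in> H"
      using x y by (intro subspace_add[OF H] subspace_scale[OF H])
    ultimately show ?thesis
      using gen x unfolding infinitesimal_generator_on_def by blast
  qed
  moreover have "((\<lambda>t. (1 / t) *\<^sub>R (exp (\<omega> * t) *\<^sub>R S t x - x)) \<longlongrightarrow> A' x) (at_right 0)" if "x \<in> D" for x
    using gen that unfolding infinitesimal_generator_on_def A'[OF that]
    by (intro difference_quotient_exp_scaleR) blast
  moreover have "x \<in> H" "A' x \<in> H" if x: "x \<in> D" for x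
  proof -
    show xH: "x \<in> H" using gen x unfolding infinitesimal_generator_on_def by blast
    obtain y where "y \<in> H" "((\<lambda>t. (1 / t) *\<^sub>R (S t x - x)) \<longlongrightarrow> y) (at_right 0)"
      using gen x unfolding infinitesimal_generator_on_def by blast
    moreover have "((\<lambda>t. (1 / t) *\<^sub>R (S t x - x)) \<longlongrightarrow> A x) (at_right 0)"
      using gen x unfolding infinitesimal_generator_on_def by blast
    ultimately have "A x \<in> H"
      using tendsto_unique[OF trivial_limit_at_right_real] by metis
    then show "A' x \<in> H"
      unfolding A'[OF x] using xH by (intro subspace_add[OF H] subspace_scale[OF H])
  qed
  ultimately show ?thesis
    unfolding infinitesimal_generator_on_def by blast
qed

text \<open>\<open>B\<close> stands for \<open>\<A> - \<omega> T\<close>, so the growth rate is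
  already absorbed.\<close>

locale dissipative_pair =
  fixes H D :: "'h::real_inner set" and T B P :: "'h \<Rightarrow> 'h" and \<epsilon> :: real
  assumes subspace_H: "subspace H" and complete_H: "complete H"
    and nontrivial: "\<exists>u\<in>H. u \<noteq> 0"
    and subspace_D: "subspace D" and D_subset: "D \<subseteq> H"
    and T: "bounded_linear_op_on H T" and bij_T: "bij_betw T H D"
    and B: "bounded_linear_op_on H B"
    and \<epsilon>_pos: "\<epsilon> > 0" and P: "bounded_linear_op_on H P" and P_coercive: "coercive_on H (\<epsilon>\<^sup>2) P"
    and dissipative: "v \<in> H \<Longrightarrow> T v \<bullet> P (B v) \<le> 0"
begin

lemmas H_intros = subspace_add[OF subspace_H] subspace_diff[OF subspace_H] subspace_scale[OF subspace_H]
lemmas T_simps = bounded_linear_op_onD[OF T] bounded_linear_op_on_diff[OF T subspace_H]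
lemmas B_simps = bounded_linear_op_onD[OF B] bounded_linear_op_on_diff[OF B subspace_H]
lemmas P_simps = bounded_linear_op_onD[OF P] bounded_linear_op_on_diff[OF P subspace_H]

lemma P_sym: "x \<in> H \<Longrightarrow> y \<in> H \<Longrightarrow> x \<bullet> P y = y \<bullet> P x"
  using P_coercive unfolding coercive_on_def self_adjoint_on_def by (metis inner_commute)

lemma P_lower: "x \<in> H \<Longrightarrow> (\<epsilon> * norm x)\<^sup>2 \<le> x \<bullet> P x"
  using P_coercive by (simp add: coercive_on_def power_mult_distrib)

lemma P_upper:
  assumes "x \<in> H" "y \<in> H"
  shows "x \<bullet> P y \<le> opnorm_on H P * norm x * norm y"
proof -
  have "x \<bullet> P y \<le> norm x * norm (P y)" by (rule norm_cauchy_schwarz)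
  also have "\<dots> \<le> norm x * (opnorm_on H P * norm y)"
    using norm_le_opnorm_on[OF P assms(2)] by (intro mult_left_mono) auto
  finally show ?thesis by (simp add: ac_simps)
qed

lemma P_nonneg: "x \<in> H \<Longrightarrow> 0 \<le> x \<bullet> P x"
  using P_lower[of x] order_trans[OF zero_le_power2] by blast

lemma P_zero:
  assumes "x \<in> H" "x \<bullet> P x \<le> 0"
  shows "x = 0"
proof -
  have "(\<epsilon> * norm x)\<^sup>2 \<le> 0" using P_lower[OF assms(1)] assms(2) by linarith
  then show ?thesis using \<epsilon>_pos by simp
qed

lemma opnorm_P: "\<epsilon>\<^sup>2 \<le> opnorm_on H P"
proof -
  obtain u where u: "u \<in> H" "u \<noteq> 0" using nontrivial by blast
  have "\<epsilon>\<^sup>2 * (norm u * norm u) \<le> opnorm_on H P * (norm u * norm u)"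
    using P_lower[OF u(1)] P_upper[OF u(1) u(1)]
    by (simp add: power2_eq_square ac_simps)
  then show ?thesis using u(2) by simp
qed

abbreviation M :: real where "M \<equiv> sqrt (opnorm_on H P) / \<epsilon>"

lemma M_ge_1: "M \<ge> 1"
  using real_le_rsqrt[OF opnorm_P] \<epsilon>_pos by simp

text \<open>The origin of the gain: the \<open>P\<close>-norm lies between \<open>\<epsilon>\<close>
  and \<open>sqrt (opnorm_on H P)\<close> times the given norm, and \<open>M\<close> is the ratio of
  these constants.\<close>

lemma norm_le_if_P_le:
  assumes "x \<in> H" "y \<in> H" "x \<bullet> P x \<le> y \<bullet> P y"
  shows "norm x \<le> M * norm y"
proof -
  have o: "opnorm_on H P \<ge> 0" using opnorm_P order_trans[OF zero_le_power2] by blast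
  have "(\<epsilon> * norm x)\<^sup>2 \<le> opnorm_on H P * norm y * norm y"
    using P_lower[OF assms(1)] P_upper[OF assms(2,2)] assms(3) by linarith
  also have "\<dots> = (sqrt (opnorm_on H P) * norm y)\<^sup>2"
    using o by (simp add: power_mult_distrib power2_eq_square mult.assoc)
  finally have "\<epsilon> * norm x \<le> sqrt (opnorm_on H P) * norm y"
    by (rule power2_le_imp_le) (use o in simp)
  then show ?thesis using \<epsilon>_pos by (simp add: field_simps)
qed

text \<open>In the expanded square the cross term is nonnegative by dissipativity and the last term
  by positivity of \<open>P\<close>.\<close>

lemma P_contraction:
  assumes "h > 0" "v \<in> H"
  shows "T v \<bullet> P (T v) \<le> (T v - h *\<^sub>R B v) \<bullet> P (T v - h *\<^sub>R B v)"
proof -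
  have "(T v - h *\<^sub>R B v) \<bullet> P (T v - h *\<^sub>R B v)
      = T v \<bullet> P (T v) - 2 * h * (T v \<bullet> P (B v)) + h\<^sup>2 * (B v \<bullet> P (B v))"
    using assms(2) P_sym[of "B v" "T v"]
    by (simp add: T_simps B_simps P_simps H_intros inner_diff_left inner_diff_right
        power2_eq_square algebra_simps)
  moreover have "h * (T v \<bullet> P (B v)) \<le> 0"
    using dissipative[OF assms(2)] assms(1) by (simp add: mult_nonneg_nonpos)
  moreover have "h\<^sup>2 * (B v \<bullet> P (B v)) \<ge> 0"
    using P_nonneg[of "B v"] assms by (simp add: B_simps)
  ultimately show ?thesis by linarith
qed

section \<open>Solvability for every step size\<close>

definition solvable :: "real \<Rightarrow> bool" where
  "solvable h \<longleftrightarrow> h > 0 \<and> (\<forall>f\<in>H. \<exists>v\<in>H. T v - h *\<^sub>R B v = f)"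

definition solution :: "real \<Rightarrow> 'h \<Rightarrow> 'h" where
  "solution h f = (SOME v. v \<in> H \<and> T v - h *\<^sub>R B v = f)"

text \<open>With \<open>A = B T^-1\<close> this is \<open>(I - h A)^-1\<close>, written as
  \<open>T (T - h B)^-1\<close>.\<close>

definition J :: "real \<Rightarrow> 'h \<Rightarrow> 'h" where
  "J h f = T (solution h f)"

lemma solution:
  assumes "solvable h" "f \<in> H"
  shows "solution h f \<in> H" "T (solution h f) - h *\<^sub>R B (solution h f) = f"
  using someI_ex[of "\<lambda>v. v \<in> H \<and> T v - h *\<^sub>R B v = f"] assms
  unfolding solution_def solvable_def by blast+

lemma J_in_D: "solvable h \<Longrightarrow> f \<in> H \<Longrightarrow> J h f \<in> D"
  unfolding J_def using solution(1) bij_T by (auto simp: bij_betw_def)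

lemma J_in: "solvable h \<Longrightarrow> f \<in> H \<Longrightarrow> J h f \<in> H"
  using J_in_D D_subset by blast

lemma T_eq_0: "v \<in> H \<Longrightarrow> T v = 0 \<Longrightarrow> v = 0"
  using bij_T T_simps(4)[of v v] subspace_0[OF subspace_H] T_simps(4)[of 0 0]
  unfolding bij_betw_def inj_on_def by simp

lemma P_J_diff:
  assumes h: "solvable h" and f: "f \<in> H" and g: "g \<in> H"
  shows "(J h f - J h g) \<bullet> P (J h f - J h g) \<le> (f - g) \<bullet> P (f - g)"
proof -
  let ?v = "solution h f - solution h g"
  have v: "?v \<in> H" using solution(1) assms by (intro H_intros)
  have "T ?v - h *\<^sub>R B ?v = (T (solution h f) - h *\<^sub>R B (solution h f)) - (T (solution h g) - h *\<^sub>R B (solution h g))"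
    using solution(1)[OF h] f g by (simp add: T_simps B_simps algebra_simps)
  then have "T ?v - h *\<^sub>R B ?v = f - g"
    using solution(2)[OF h] f g by simp
  moreover have "T ?v = J h f - J h g"
    unfolding J_def using solution(1)[OF h] f g by (simp add: T_simps)
  ultimately show ?thesis
    using P_contraction[OF _ v, of h] h by (simp add: solvable_def)
qed

text \<open>With \<open>q = 1 - h / k\<close> the equation for \<open>k\<close> reads \<open>T v - h *\<^sub>R B v = g\<close> where \<open>g\<close> is the fixed
  point of \<open>g \<mapsto> (h / k) *\<^sub>R f + q *\<^sub>R J h g\<close>, a contraction in the \<open>P\<close>-norm as \<open>\<bar>q\<bar> < 1\<close>.\<close>

lemma solvable_step:
  assumes h: "solvable h" and k: "k > h / 2"
  shows "solvable k"
  unfolding solvable_def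
proof (intro conjI ballI)
  have h0: "h > 0" using h by (simp add: solvable_def)
  then show k0: "k > 0" using k by linarith
  fix f assume f: "f \<in> H"
  define q where "q = 1 - h / k"
  \<comment> \<open>The threshold \<open>h / 2\<close> enters here: \<open>\<bar>q\<bar> < 1\<close>
    amounts to \<open>0 < h / k < 2\<close>.\<close>
  have q: "\<bar>q\<bar> < 1" unfolding q_def using h0 k0 k by (auto simp: abs_less_iff field_simps)
  define step where "step g = (h / k) *\<^sub>R f + q *\<^sub>R J h g" for g
  define X where "X n = (step ^^ n) 0" for n
  have step_in: "step g \<in> H" if "g \<in> H" for g
    unfolding step_def using f that h by (intro H_intros J_in)
  have X: "X n \<in> H" for n
    unfolding X_def by (induction n) (auto intro: step_in subspace_0[OF subspace_H])
  have X_Suc: "X (Suc n) = step (X n)" for n by (simp add: X_def)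
  have contr: "(step g - step g') \<bullet> P (step g - step g') \<le> q\<^sup>2 * ((g - g') \<bullet> P (g - g'))"
    if "g \<in> H" "g' \<in> H" for g g'
  proof -
    have "step g - step g' = q *\<^sub>R (J h g - J h g')" by (simp add: step_def scaleR_diff_right)
    then have "(step g - step g') \<bullet> P (step g - step g') = q\<^sup>2 * ((J h g - J h g') \<bullet> P (J h g - J h g'))"
      using that h by (simp add: P_simps J_in H_intros power2_eq_square mult.assoc)
    also have "\<dots> \<le> q\<^sup>2 * ((g - g') \<bullet> P (g - g'))"
      using P_J_diff[OF h that] by (intro mult_left_mono) auto
    finally show ?thesis .
  qed
  let ?p = "\<lambda>x. x \<bullet> P x"
  have decay: "?p (X (Suc n) - X n) \<le> (\<bar>q\<bar> ^ n)\<^sup>2 * ?p (X 1 - X 0)" for n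
  proof (induction n)
    case (Suc n)
    have "?p (X (Suc (Suc n)) - X (Suc n)) \<le> q\<^sup>2 * ?p (X (Suc n) - X n)"
      unfolding X_Suc[of "Suc n"] X_Suc[of n] by (rule contr) (use X X_Suc in metis)+
    also have "\<dots> \<le> q\<^sup>2 * ((\<bar>q\<bar> ^ n)\<^sup>2 * ?p (X 1 - X 0))"
      using Suc by (intro mult_left_mono) auto
    finally show ?case by (simp add: power_mult_distrib)
  qed simp
  let ?C = "sqrt (?p (X 1 - X 0)) / \<epsilon>"
  have p0: "?p (X 1 - X 0) \<ge> 0" using X by (intro P_nonneg H_intros)
  have "Cauchy X"
  proof (rule Cauchy_of_geometric_steps)
    fix n
    have "(\<epsilon> * norm (X (Suc n) - X n))\<^sup>2 \<le> ?p (X (Suc n) - X n)"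
      using X by (intro P_lower H_intros)
    also have "\<dots> \<le> (\<bar>q\<bar> ^ n * sqrt (?p (X 1 - X 0)))\<^sup>2"
      using decay[of n] p0 by (simp only: power_mult_distrib real_sqrt_pow2)
    finally have "\<epsilon> * norm (X (Suc n) - X n) \<le> \<bar>q\<bar> ^ n * sqrt (?p (X 1 - X 0))"
      by (rule power2_le_imp_le) (use p0 in simp)
    then show "norm (X (Suc n) - X n) \<le> ?C * \<bar>q\<bar> ^ n"
      using \<epsilon>_pos by (simp add: field_simps)
  qed (use q in auto)
  then obtain g where g: "g \<in> H" "X \<longlonglongrightarrow> g"
    using completeE[OF complete_H, of X] X by auto
  have "(\<lambda>n. X (Suc n)) \<longlonglongrightarrow> step g"
  proof (rule LIM_zero_cancel, rule Lim_null_comparison)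
    show "(\<lambda>n. \<bar>q\<bar> * (M * norm (X n - g))) \<longlonglongrightarrow> 0"
      using g(2) by (intro tendsto_mult_right_zero tendsto_norm_zero) (simp add: LIM_zero)
    have "norm (X (Suc n) - step g) \<le> \<bar>q\<bar> * (M * norm (X n - g))" for n
    proof -
      have "X (Suc n) - step g = q *\<^sub>R (J h (X n) - J h g)"
        by (simp add: X_Suc step_def scaleR_diff_right)
      \<comment> \<open>Returning from the \<open>P\<close>-norm to the given norm makes
        \<open>J h\<close> Lipschitz with constant \<open>M\<close>.\<close>
      moreover have "norm (J h (X n) - J h g) \<le> M * norm (X n - g)"
        using X g(1) h by (intro norm_le_if_P_le P_J_diff H_intros J_in)
      ultimately show ?thesis by (simp add: mult_left_mono del: times_divide_eq_left)
    qed
    then show "\<forall>\<^sub>F n in sequentially. norm (X (Suc n) - step g) \<le> \<bar>q\<bar> * (M * norm (X n - g))" by simp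
  qed
  moreover have "(\<lambda>n. X (Suc n)) \<longlonglongrightarrow> g" using g(2) by (rule LIMSEQ_Suc)
  ultimately have fixed: "g = step g" using LIMSEQ_unique by blast
  let ?v = "solution h g"
  have "T ?v - h *\<^sub>R B ?v = (h / k) *\<^sub>R f + (1 - h / k) *\<^sub>R T ?v"
    using solution(2)[OF h g(1)] fixed by (simp add: step_def J_def q_def)
  then have "(h / k) *\<^sub>R T ?v - h *\<^sub>R B ?v = (h / k) *\<^sub>R f"
    by (simp add: algebra_simps)
  then have "(k / h) *\<^sub>R ((h / k) *\<^sub>R T ?v - h *\<^sub>R B ?v) = (k / h) *\<^sub>R ((h / k) *\<^sub>R f)"
    by simp
  then have "T ?v - k *\<^sub>R B ?v = f"
    using h0 k0 by (simp add: scaleR_diff_right)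
  then show "\<exists>v\<in>H. T v - k *\<^sub>R B v = f"
    using solution(1)[OF h g(1)] by blast
qed

text \<open>One step reaches every larger \<open>k\<close> and goes down to just above half, so
  finitely many near-halvings reach any positive \<open>k\<close>.\<close>

lemma solvable_all:
  assumes h: "solvable h" and k: "k > 0"
  shows "solvable k"
proof -
  have h0: "h > 0" using h by (simp add: solvable_def)
  have halving: "solvable l" if "l > h * (1/2) ^ n" for n l
    using that
  proof (induction n arbitrary: l)
    case 0
    show ?case by (rule solvable_step[OF h]) (use 0 h0 in simp)
  next
    case (Suc n)
    then have "h * (1/2) ^ n < 2 * l" by simp
    \<comment> \<open>\<open>dense\<close> is density of the real order. The strict threshold in
      \<open>solvable_step\<close> calls for an intermediate step size \<open>m\<close>.\<close>
    from dense[OF this] obtain m where m: "h * (1/2) ^ n < m" "m < 2 * l" by blast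
    from solvable_step[OF Suc.IH[OF m(1)], of l] m(2) show ?case by simp
  qed
  obtain n where "(1/2) ^ n < k / h"
    using real_arch_pow_inv[of "k / h" "1/2"] h0 k by auto
  then show ?thesis using h0 by (intro halving[of n]) (simp add: field_simps)
qed

text \<open>In the \<open>P\<close>-inner product nothing but \<open>0\<close> is orthogonal to \<open>D\<close>: if \<open>T v - B v\<close> is, then
  \<open>\<langle>T v, P (T v)\<rangle> = \<langle>T v, P (B v)\<rangle> \<le> 0\<close>.\<close>

lemma D_dense:
  assumes h: "solvable 1" and x: "x \<in> H" and e: "e > 0"
  shows "\<exists>y\<in>D. norm (x - y) < e"
proof -
  let ?K = "H \<inter> closure D"
  have K: "subspace ?K" "complete ?K"
    using subspace_H complete_H subspace_D
    by (auto intro!: subspace_inter subspace_closure complete_Int_closed)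
  \<comment> \<open>\<open>z\<close> is the \<open>P\<close>-orthogonal projection of
    \<open>x\<close> onto the part of the closure of \<open>D\<close> in \<open>H\<close>.\<close>
  have "\<exists>z\<in>?K. \<forall>w\<in>?K. w \<bullet> P z = w \<bullet> P x"
  proof (rule symmetric_lax_milgram[OF K, where c = "\<epsilon>\<^sup>2" and C = "opnorm_on H P" and L = "norm (P x)"])
    fix y show "y \<bullet> P x \<le> norm (P x) * norm y"
      using norm_cauchy_schwarz[of y "P x"] by (simp add: mult.commute)
  next
    fix y assume "y \<in> ?K"
    then show "\<epsilon>\<^sup>2 * (norm y)\<^sup>2 \<le> y \<bullet> P y"
      using P_lower[of y] by (simp add: power_mult_distrib)
  qed (use \<epsilon>_pos P_sym P_upper in \<open>auto simp: inner_add_left\<close>)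
  then obtain z where z: "z \<in> H" "z \<in> closure D" "\<And>w. w \<in> ?K \<Longrightarrow> w \<bullet> P z = w \<bullet> P x" by blast
  have y: "x - z \<in> H" using x z by (intro H_intros)
  let ?v = "solution 1 (x - z)"
  have v: "?v \<in> H" "T ?v - B ?v = x - z"
    using solution[OF h y] by auto
  have Tv: "T ?v \<in> H" "B ?v \<in> H" "T ?v \<in> ?K"
    using v(1) T_simps(1) B_simps(1) J_in_D[OF h y] closure_subset by (auto simp: J_def)
  have "T ?v \<bullet> P (T ?v - B ?v) = 0"
    unfolding v(2) using z(3)[OF Tv(3)] x z(1) by (simp add: P_simps inner_diff_right)
  then have "T ?v \<bullet> P (T ?v) = T ?v \<bullet> P (B ?v)"
    using Tv by (simp add: P_simps inner_diff_right)
  then have "T ?v = 0"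
    using dissipative[OF v(1)] Tv by (intro P_zero) auto
  then have "?v = 0" using T_eq_0 v(1) by blast
  then have "x = z"
    using v(2) \<open>T ?v = 0\<close> B_simps(4)[of 0 0] subspace_0[OF subspace_H] by simp
  then show ?thesis
    using z(2) e unfolding closure_approachable by (metis dist_commute dist_norm)
qed

lemma A_T: "v \<in> H \<Longrightarrow> (B \<circ> inv_into H T) (T v) = B v"
  using bij_T by (simp add: bij_betw_def)

lemma D_range: "x \<in> D \<Longrightarrow> \<exists>v\<in>H. x = T v"
  using bij_T by (auto simp: bij_betw_def)

text \<open>For right-hand side 0, \<open>P_contraction\<close> makes \<open>T v\<close> vanish, so
  \<open>J\<close> does not depend on the choice made in \<open>solution\<close>.\<close>

lemma solution_unique:
  assumes h: "solvable h" and v: "v \<in> H"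
  shows "J h (T v - h *\<^sub>R B v) = T v"
proof -
  let ?f = "T v - h *\<^sub>R B v"
  have f: "?f \<in> H" using v by (simp add: T_simps B_simps H_intros)
  let ?d = "solution h ?f - v"
  have d: "?d \<in> H" using solution(1)[OF h f] v by (intro H_intros)
  have "T ?d - h *\<^sub>R B ?d = (T (solution h ?f) - h *\<^sub>R B (solution h ?f)) - ?f"
    using solution(1)[OF h f] v by (simp add: T_simps B_simps algebra_simps)
  also have "\<dots> = 0" using solution(2)[OF h f] by simp
  finally have "T ?d \<bullet> P (T ?d) \<le> 0"
    using P_contraction[OF _ d, of h] h by (simp add: solvable_def)
  then have "T ?d = 0" using d by (intro P_zero) (simp_all add: T_simps)
  then show ?thesis
    using solution(1)[OF h f] v by (simp add: J_def T_simps)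
qed

lemma J_zero: "solvable h \<Longrightarrow> J h 0 = 0"
  using solution_unique[of h 0] T_simps(4)[of 0 0] B_simps(4)[of 0 0] subspace_0[OF subspace_H] by simp

lemma norm_J_power:
  assumes h: "solvable h" and x: "x \<in> H"
  shows "norm ((J h ^^ n) x) \<le> M * norm x"
proof -
  have "(J h ^^ n) x \<in> H \<and> (J h ^^ n) x \<bullet> P ((J h ^^ n) x) \<le> x \<bullet> P x"
  proof (induction n)
    case (Suc n)
    then show ?case
      using P_J_diff[OF h, of "(J h ^^ n) x" 0] J_in[OF h] J_zero[OF h] subspace_0[OF subspace_H]
      by auto
  qed (use x in simp)
  then show ?thesis using x by (intro norm_le_if_P_le) auto
qed

lemma resolvent_family:
  assumes "solvable h"
  shows "resolvent_family H D (B \<circ> inv_into H T) J M"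
proof
  let ?A = "B \<circ> inv_into H T"
  have solv: "solvable h" if "h > 0" for h using solvable_all[OF assms that] .
  show "subspace H" "complete H" "subspace D" "D \<subseteq> H" "M \<ge> 1"
    by (fact subspace_H complete_H subspace_D D_subset M_ge_1)+
  show "?A x \<in> H" if "x \<in> D" for x
    using D_range[OF that] A_T B_simps(1) by metis
  show "?A (x + y) = ?A x + ?A y" if xy: "x \<in> D" "y \<in> D" for x y
  proof -
    obtain v w where vw: "v \<in> H" "x = T v" "w \<in> H" "y = T w"
      using D_range[OF xy(1)] D_range[OF xy(2)] by blast
    have "?A (x + y) = ?A (T (v + w))" unfolding vw(2,4) T_simps(2)[OF vw(1,3)] ..
    also have "\<dots> = B (v + w)" using vw by (intro A_T H_intros)
    also have "\<dots> = ?A x + ?A y" unfolding vw(2,4) A_T[OF vw(1)] A_T[OF vw(3)] using vw(1,3) by (rule B_simps)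
    finally show ?thesis .
  qed
  show "?A (c *\<^sub>R x) = c *\<^sub>R ?A x" if x: "x \<in> D" for c x
  proof -
    obtain v where v: "v \<in> H" "x = T v" using D_range[OF x] by blast
    have "?A (c *\<^sub>R x) = ?A (T (c *\<^sub>R v))" unfolding v(2) T_simps(3)[OF v(1)] ..
    also have "\<dots> = B (c *\<^sub>R v)" using v by (intro A_T H_intros)
    also have "\<dots> = c *\<^sub>R ?A x" unfolding v(2) A_T[OF v(1)] using v(1) by (rule B_simps)
    finally show ?thesis .
  qed
  show "J h x \<in> D" if "h > 0" "x \<in> H" for h x
    using that J_in_D solv by blast
  show "J h x - h *\<^sub>R ?A (J h x) = x" if "h > 0" "x \<in> H" for h x
    using solution[OF solv[OF that(1)] that(2)] unfolding J_def by (simp only: A_T)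
  show "J h (x - h *\<^sub>R ?A x) = x" if hx: "h > 0" "x \<in> D" for h x
  proof -
    obtain v where "v \<in> H" "x = T v" using D_range[OF hx(2)] by blast
    then show ?thesis using solution_unique[OF solv[OF hx(1)]] by (simp only: A_T)
  qed
  show "norm ((J h ^^ n) x) \<le> M * norm x" if "h > 0" "x \<in> H" for h x n
    using norm_J_power solv that by blast
  show "\<exists>y\<in>D. norm (x - y) < e" if "x \<in> H" "e > 0" for x e
    using D_dense solv that by simp
qed

end

section \<open>The generation theorem on a complete subspace\<close>

theorem generator_of_dissipative_pair:
  fixes H D :: "'h::real_inner set" and T \<A> P :: "'h \<Rightarrow> 'h" and \<epsilon> \<epsilon>' \<mu> \<omega> :: real
  assumes H: "subspace H" "complete H" "\<exists>u\<in>H. u \<noteq> 0"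
    and D: "subspace D" "D \<subseteq> H"
    and T_op: "bounded_linear_op_on H T" "bij_betw T H D"
    and \<A>: "bounded_linear_op_on H \<A>"
    and P_op: "\<epsilon> > 0" "bounded_linear_op_on H P" "coercive_on H (\<epsilon>\<^sup>2) P"
    and dissipative: "\<And>v. v \<in> H \<Longrightarrow> T v \<bullet> P (\<A> v) \<le> \<omega> * (T v \<bullet> P (T v))"
    and below: "\<epsilon>' > 0" "\<mu> > \<omega>"
      "\<And>v. v \<in> H \<Longrightarrow> \<epsilon>' * norm v \<le> norm (\<mu> *\<^sub>R adjoint_on H T v - adjoint_on H \<A> v)"
  shows "\<exists>S. C0_semigroup_on H S \<and> infinitesimal_generator_on H S D (\<A> \<circ> inv_into H T) \<and>
    has_growth_on H S \<omega> (sqrt (opnorm_on H P) / \<epsilon>)"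
proof -
  define B where "B v = 1 *\<^sub>R \<A> v + (- \<omega>) *\<^sub>R T v" for v
  have B_op: "bounded_linear_op_on H B"
    unfolding B_def by (rule bounded_linear_op_on_combine[OF H(1) \<A> T_op(1)])
  have "T v \<bullet> P (B v) \<le> 0" if "v \<in> H" for v
    using dissipative[OF that] that bounded_linear_op_onD[OF P_op(2)] bounded_linear_op_onD(1)[OF T_op(1)]
      bounded_linear_op_onD(1)[OF \<A>] subspace_scale[OF H(1)]
    unfolding B_def by (simp add: inner_add_right inner_diff_right del: scaleR_minus_left)
  then interpret dissipative_pair H D T B P \<epsilon>
    using H D T_op B_op P_op by unfold_locales
  \<comment> \<open>Since \<open>\<mu> T - \<A> = (\<mu> - \<omega>) (T - ?h B)\<close>, condition
    (2) yields surjectivity for exactly this step.\<close>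
  let ?h = "1 / (\<mu> - \<omega>)"
  have "solvable ?h"
    unfolding solvable_def
  proof (intro conjI ballI)
    show "?h > 0" using below(2) by simp
    fix f assume f: "f \<in> H"
    let ?R = "\<lambda>v. \<mu> *\<^sub>R T v + (- 1) *\<^sub>R \<A> v"
    \<comment> \<open>The adjoint of \<open>?R\<close> is, taken termwise, the operator that
      condition (2) bounds below.\<close>
    have "\<exists>v\<in>H. ?R v = (\<mu> - \<omega>) *\<^sub>R f"
    proof (rule surj_if_adjoint_bounded_below[OF H(1,2) _ below(1)])
      show "bounded_linear_op_on H ?R"
        by (rule bounded_linear_op_on_combine[OF H(1) T_op(1) \<A>])
      show "\<epsilon>' * norm v \<le> norm (adjoint_on H ?R v)" if "v \<in> H" for v
        using below(3)[OF that] unfolding adjoint_on_combine[OF H(1,2) T_op(1) \<A> that] by simp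
      show "(\<mu> - \<omega>) *\<^sub>R f \<in> H" using f by (rule subspace_scale[OF H(1)])
    qed
    then obtain v where v: "v \<in> H" "?R v = (\<mu> - \<omega>) *\<^sub>R f" by blast
    have "T v - ?h *\<^sub>R B v = ?h *\<^sub>R ((\<mu> - \<omega>) *\<^sub>R T v - B v)"
      using below(2) by (simp add: scaleR_diff_right)
    also have "(\<mu> - \<omega>) *\<^sub>R T v - B v = (\<mu> - \<omega>) *\<^sub>R f"
      using v(2) by (simp add: B_def algebra_simps)
    finally show "\<exists>v\<in>H. T v - ?h *\<^sub>R B v = f"
      using v(1) below(2) by (intro bexI[of _ v]) auto
  qed
  then interpret resolvent_family H D "B \<circ> inv_into H T" J M
    by (rule resolvent_family)
  \<comment> \<open>The derivative of the exponential factor at 0 restores the term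
    \<open>\<omega> *\<^sub>R x\<close> removed by the shift.\<close>
  let ?S = "\<lambda>t x. exp (\<omega> * t) *\<^sub>R semigroup t x"
  have "C0_semigroup_on H ?S"
    by (rule C0_semigroup_on_rescale[OF C0_semigroup_on_semigroup H(1)])
  moreover have "infinitesimal_generator_on H ?S D (\<A> \<circ> inv_into H T)"
  proof (rule infinitesimal_generator_on_rescale[OF generator_semigroup H(1)])
    fix x assume "x \<in> D"
    then have "T (inv_into H T x) = x"
      using T_op(2) by (auto simp: bij_betw_def intro: f_inv_into_f)
    then show "(\<A> \<circ> inv_into H T) x = (B \<circ> inv_into H T) x + \<omega> *\<^sub>R x"
      by (simp add: B_def)
  qed
  moreover have "has_growth_on H ?S \<omega> M"
    unfolding has_growth_on_def
  proof (intro conjI allI impI)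
    fix t :: real assume t: "t \<ge> 0"
    show "opnorm_on H (?S t) \<le> M * exp (\<omega> * t)"
    proof (rule opnorm_on_le)
      show "H \<noteq> {}" using H(3) by blast
      show "M * exp (\<omega> * t) \<ge> 0" using M_ge_1 by (intro mult_nonneg_nonneg) auto
      fix x assume "x \<in> H"
      then show "norm (?S t x) \<le> M * exp (\<omega> * t) * norm x"
        using semigroup_bound[OF t, of x] by (simp add: mult_left_mono ac_simps del: times_divide_eq_left times_divide_eq_right)
    qed
  qed (rule M_ge_1)
  ultimately show ?thesis by blast
qed

section \<open>The case of square-integrable functions on an interval\<close>

theorem theorem12:
  fixes a b \<omega> \<epsilon>\<^sub>1 :: real
    and H D :: "(real ^ 'n) L2 set"
    and T \<A> P A :: "(real ^ 'n) L2 \<Rightarrow> (real ^ 'n) L2"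
  assumes "a < b"
    and H: "H = L2_on a b"
    and "subspace D" "D \<subseteq> H"
    and "bounded_linear_op_on H T" "bij_betw T H D"
    and "bounded_linear_op_on H \<A>"
    and A: "A = \<A> \<circ> inv_into H T"
    and "\<epsilon>\<^sub>1 > 0" "bounded_linear_op_on H P" "coercive_on H (\<epsilon>\<^sub>1\<^sup>2) P"
    and "\<forall>v\<in>H. weighted_inner P (T v) (\<A> v) \<le> \<omega> * weighted_inner P (T v) (T v)"
    and "\<exists>\<epsilon>\<^sub>2>0. \<exists>\<mu>>\<omega>. \<forall>v\<in>H.
      norm (\<mu> *\<^sub>R adjoint_on H T v - adjoint_on H \<A> v) \<ge> \<epsilon>\<^sub>2 * norm v"
  shows "\<exists>S. C0_semigroup_on H S \<and> infinitesimal_generator_on H S D A \<and>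
    has_growth_on H S \<omega> (sqrt (opnorm_on H P) / \<epsilon>\<^sub>1)"
proof -
  have H': "subspace H" "complete H"
    unfolding H L2_on_def by (rule subspace_vanishes_off complete_vanishes_off)+
  obtain \<epsilon>\<^sub>2 \<mu> where "\<epsilon>\<^sub>2 > 0" "\<mu> > \<omega>"
    "\<forall>v\<in>H. norm (\<mu> *\<^sub>R adjoint_on H T v - adjoint_on H \<A> v) \<ge> \<epsilon>\<^sub>2 * norm v"
    using assms(13) by blast
  then show ?thesis
    unfolding A
    using H' L2_on_nontrivial[OF assms(1), where ?'a = "real ^ 'n"] assms(3-7,9-12)
    by (intro generator_of_dissipative_pair) (auto simp: H weighted_inner_def)
qed

end
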